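(* Let $\nu>0$. Then the radius of uniform convexity $r^{uc}(f_\nu)$ of the function $f_{\nu}(z)=\left(2^{\nu}\Gamma(\nu+1)J_{\nu}(z)\right)^{1/\nu}$ is the smallest positive root $r$ of the equation $$1+2\,\frac{(r^{2}-\nu^{2})J_{\nu}(r)}{rJ_{\nu}'(r)}+2\left(1-\frac{1}{\nu}\right)\frac{rJ_{\nu}'(r)}{J_{\nu}(r)}=0.$$ Moreover, $r^{uc}(f_{\nu})<r^{c}(f_{\nu})<j_{\nu,1}'<j_{\nu,1}$, where $j_{\nu,1}$ and $j_{\nu,1}'$ denote the first positive zeros of $J_{\nu}$ and $J_{\nu}'$, respectively, and $r^{c}(f_{\nu})$ is the radius of convexity of $f_{\nu}$.
   Context: $J_\nu$ is the Bessel function of the first kind of order $\nu$: $J_{\nu}(z)=\sum_{n\ge 0}\frac{(-1)^{n}}{n!\,\Gamma(n+\nu+1)}\left(\frac z2\right)^{2n+\nu}$. The normalized function is $f_\nu(z)=\left(2^{\nu}\Gamma(\nu+1)J_{\nu}(z)\right)^{1/\nu}=z-\frac{1}{4\nu(\nu+1)}z^{3}+\dots$, i.e. $f_\nu(z)=z\,\left(2^\nu\Gamma(\nu+1)z^{-\nu}J_\nu(z)\right)^{1/\nu}$, with the branch of the power equal to $1$ at $z=0$. Write $U(r)=\{z\in\mathbb C:|z|<r\}$. For $f(z)=z+\sum_{n\ge2}a_nz^n$ with radius of convergence $r_f\in(0,\infty]$, the radius of convexity is $$r^{c}(f)=\sup\left\{r\in(0,r_f):\ \operatorname{Re}\left(1+\frac{zf''(z)}{f'(z)}\right)>0\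 \text{for all } z\in U(r)\right\}$$ and the radius of uniform convexity is $$r^{uc}(f)=\sup\left\{r\in(0,r_f):\ \operatorname{Re}\left(1+\frac{zf''(z)}{f'(z)}\right)>\left|\frac{zf''(z)}{f'(z)}\right|\ \text{for all } z\in U(r)\right\}.$$ *)

theory Defs
  imports "HOL-Complex_Analysis.Complex_Analysis"
begin

text \<open>
  On the real type the defining formula is meaningful for positive arguments; on the complex type
  \<open>powr\<close> selects the principal branch of \<open>(z / 2) powr \<nu>\<close>.
\<close>

definition bessel_J :: "'a \<Rightarrow> 'a \<Rightarrow> 'a :: {Gamma, ln}" where
  "bessel_J \<nu> z =
     (\<Sum>n. (- 1) ^ n / (fact n * Gamma (of_nat n + \<nu> + 1)) * (z / 2) powr (of_nat (2 * n) + \<nu>))"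

text \<open>
  The function \<open>f\<^sub>\<nu>\<close> is represented by its power series at the origin, so that it is
  defined on the whole disc of convergence. For \<open>z \<noteq> 0\<close> the quantity
  \<open>2\<^sup>\<nu> \<Gamma>(\<nu> + 1) z\<^sup>-\<^sup>\<nu> J\<^sub>\<nu>(z)\<close>, formed with principal branches, is the restriction of an even entire
  function with value \<open>1\<close> at \<open>0\<close>; hence near the origin the principal
  \<open>\<nu>\<close>-th root is the branch that equals \<open>1\<close> at \<open>0\<close>. At \<open>z = 0\<close> itself the leading factor
  \<open>z\<close> gives the correct value \<open>0\<close>. Further away from the origin the principal root may
  jump, and only the power series is used there.
\<close>

definition bessel_f :: "real \<Rightarrow> complex fps" where
  "bessel_f \<nu> = fps_expansion (\<lambda>z. z *
     (2 powr of_real \<nu> * Gamma (of_real \<nu> + 1) * z powr (- of_real \<nu>) * bessel_J (of_real \<nu>) z)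
       powr (1 / of_real \<nu>)) 0"

text \<open>
  In both radii the condition \<open>deriv f z \<noteq> 0\<close> states that the quotient \<open>z f''(z) / f'(z)\<close> is
  defined; without it, division by zero would make the inequalities hold at zeros of \<open>f'\<close>.
  The radii are extended reals because they may be infinite.
\<close>

definition radius_of_convexity :: "complex fps \<Rightarrow> ereal" where
  "radius_of_convexity F = (let f = eval_fps F in
     Sup {ereal r | r. 0 < r \<and> ereal r < fps_conv_radius F \<and>
       (\<forall>z\<in>ball 0 r. deriv f z \<noteq> 0 \<and> Re (1 + z * deriv (deriv f) z / deriv f z) > 0)})"

definition radius_of_uniform_convexity :: "complex fps \<Rightarrow> ereal" where
  "radius_of_uniform_convexity F = (let f = eval_fps F in
     Sup {ereal r | r. 0 < r \<and> ereal r < fps_conv_radius F \<and>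
       (\<forall>z\<in>ball 0 r. deriv f z \<noteq> 0 \<and>
          Re (1 + z * deriv (deriv f) z / deriv f z) > norm (z * deriv (deriv f) z / deriv f z))})"

definition smallest_positive :: "(real \<Rightarrow> bool) \<Rightarrow> real \<Rightarrow> bool" where
  "smallest_positive P r \<longleftrightarrow> 0 < r \<and> P r \<and> (\<forall>s. 0 < s \<and> P s \<longrightarrow> r \<le> s)"

text \<open>A root is required to be a point where neither denominator vanishes.\<close>

definition uniform_convexity_equation :: "real \<Rightarrow> real \<Rightarrow> bool" where
  "uniform_convexity_equation \<nu> r \<longleftrightarrow>
     bessel_J \<nu> r \<noteq> 0 \<and> deriv (bessel_J \<nu>) r \<noteq> 0 \<and>
     1 + 2 * ((r\<^sup>2 - \<nu>\<^sup>2) * bessel_J \<nu> r / (r * deriv (bessel_J \<nu>) r))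
       + 2 * (1 - 1 / \<nu>) * (r * deriv (bessel_J \<nu>) r / bessel_J \<nu> r) = 0"

end

theory Submission
  imports Defs
begin

text \<open>
  Up to a constant factor, \<open>J\<^sub>\<nu>(z) = z\<^sup>\<nu> e(z)\<close> with \<open>e\<close> even and entire, \<open>e(0) = 1\<close>. Bessel's equation
  becomes a Riccati equation for \<open>L = - e' / e\<close>, and comparing Taylor coefficients shows that all
  coefficients of \<open>L\<close>, and hence those of \<open>h = \<integral> L\<close>, are nonnegative. As \<open>e = exp (- h)\<close>, it follows
  that \<open>\<bar>e(z)\<bar> \<ge> e(\<bar>z\<bar>)\<close> in every zero-free disc, so \<open>e\<close> has no complex zeros of modulus less than the
  first positive zero \<open>j\<close> of \<open>J\<^sub>\<nu>\<close>, and \<open>f\<^sub>\<nu>(z) = z exp (- h(z) / \<nu>)\<close> for \<open>\<bar>z\<bar> < j\<close>. Put \<open>S = z L\<close>. Then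
  \<open>z f'' / f' = - Q\<close> with \<open>Q = S / \<nu> + z S' / (\<nu> - S)\<close>, where \<open>S\<close> and \<open>z S'\<close> have nonnegative
  coefficients and \<open>S = \<nu>\<close> at the first positive zero \<open>j'\<close> of \<open>J\<^sub>\<nu>'\<close>. Therefore \<open>\<bar>Q(z)\<bar> \<le> Q(\<bar>z\<bar>)\<close> for
  \<open>\<bar>z\<bar> < j'\<close>, and \<open>Q\<close> increases from \<open>0\<close> to \<open>\<infinity>\<close> on \<open>[0, j')\<close>; the radius of convexity is the point where
  \<open>Q = 1\<close>, and that of uniform convexity the point where \<open>Q = 1/2\<close>. No information on the other zeros
  of \<open>J\<^sub>\<nu>\<close> and \<open>J\<^sub>\<nu>'\<close> is needed.
\<close>

section \<open>The entire part of the Bessel function\<close>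

text \<open>The Pochhammer symbol is \<Gamma>(n + \<nu> + 1) / \<Gamma>(\<nu> + 1): these
  coefficients of z^(2n) remain once (z/2)^\<nu> / \<Gamma>(\<nu> + 1) is factored out of J.\<close>

definition bessel_coeff :: "real \<Rightarrow> nat \<Rightarrow> real" where
  "bessel_coeff \<nu> n = (- 1) ^ n / (4 ^ n * fact n * pochhammer (\<nu> + 1) n)"

text \<open>A series in w = z^2, so that consecutive coefficients are linked directly; the generic
  type serves real and complex arguments alike.\<close>

definition bessel_fps :: "real \<Rightarrow> 'a :: {banach, real_normed_field} fps" where
  "bessel_fps \<nu> = Abs_fps (\<lambda>n. of_real (bessel_coeff \<nu> n))"

definition bessel_E :: "real \<Rightarrow> 'a \<Rightarrow> 'a :: {banach, real_normed_field}" where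
  "bessel_E \<nu> z = eval_fps (bessel_fps \<nu>) (z\<^sup>2)"

definition bessel_E' :: "real \<Rightarrow> 'a \<Rightarrow> 'a :: {banach, real_normed_field}" where
  "bessel_E' \<nu> z = 2 * z * eval_fps (fps_deriv (bessel_fps \<nu>)) (z\<^sup>2)"

text \<open>
  With \<open>e = bessel_E \<nu>\<close> we have \<open>J\<^sub>\<nu>(z) = (z / 2)\<^sup>\<nu> e(z) / \<Gamma>(\<nu> + 1)\<close>; \<open>bessel_L \<nu>\<close> is \<open>- e' / e\<close>,
  a solution of the Riccati equation \<open>z L' = z - (2 \<nu> + 1) L + z L\<^sup>2\<close>.
\<close>

definition bessel_L :: "real \<Rightarrow> 'a \<Rightarrow> 'a :: {banach, real_normed_field}" where
  "bessel_L \<nu> z = - bessel_E' \<nu> z / bessel_E \<nu> z"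

text \<open>The quotient rule written out: - e'' / e + (e' / e)^2.\<close>

definition bessel_L' :: "real \<Rightarrow> 'a \<Rightarrow> 'a :: {banach, real_normed_field}" where
  "bessel_L' \<nu> z =
     - (2 * eval_fps (fps_deriv (bessel_fps \<nu>)) (z\<^sup>2)
        + 4 * z\<^sup>2 * eval_fps (fps_deriv (fps_deriv (bessel_fps \<nu>))) (z\<^sup>2)) / bessel_E \<nu> z
     + (bessel_L \<nu> z)\<^sup>2"

section \<open>Convergence, Bessel's equation and the Riccati equation\<close>

lemma pochhammer_ge_1: "pochhammer (x :: real) n \<ge> 1" if "x \<ge> 1"
proof (induction n)
  case (Suc n)
  have "1 * 1 \<le> pochhammer x n * (x + of_nat n)"
    using Suc that by (intro mult_mono) auto
  then show ?case by (simp add: pochhammer_Suc)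
qed auto

text \<open>Both 4^n and the Pochhammer symbol are at least 1. The bound by the exponential series
  makes the series entire.\<close>

lemma abs_bessel_coeff_le: "\<bar>bessel_coeff \<nu> n\<bar> \<le> inverse (fact n)" if "\<nu> > 0"
proof -
  have "(fact n :: real) * 1 \<le> fact n * (4 ^ n * pochhammer (\<nu> + 1) n)"
    using pochhammer_ge_1[of "\<nu> + 1" n] that
    by (intro mult_left_mono order.trans[OF _ mult_mono[of 1 "4 ^ n" 1]]) auto
  moreover have "pochhammer (\<nu> + 1) n > 0"
    using pochhammer_ge_1[of "\<nu> + 1" n] that by linarith
  ultimately show ?thesis
    by (simp add: bessel_coeff_def field_simps abs_mult power_abs)
qed

lemma fps_conv_radius_bessel_fps [simp]:
  "fps_conv_radius (bessel_fps \<nu> :: 'a :: {banach, real_normed_field} fps) = \<infinity>" if "\<nu> > 0"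
  unfolding fps_conv_radius_def
proof (rule conv_radius_inftyI'')
  fix z :: 'a
  show "summable (\<lambda>n. fps_nth (bessel_fps \<nu>) n * z ^ n)"
  proof (rule summable_comparison_test[OF _ summable_exp[of "norm z"]], intro exI allI impI)
    fix n
    show "norm (fps_nth (bessel_fps \<nu>) n * z ^ n) \<le> inverse (fact n) * norm z ^ n"
      using abs_bessel_coeff_le[OF that, of n]
      by (auto simp: bessel_fps_def norm_mult norm_power intro!: mult_right_mono)
  qed
qed

lemma fps_conv_radius_deriv_bessel_fps [simp]:
  assumes "\<nu> > 0"
  shows "fps_conv_radius (fps_deriv (bessel_fps \<nu> :: 'a :: {banach, real_normed_field} fps)) = \<infinity>"
    "fps_conv_radius (fps_deriv (fps_deriv (bessel_fps \<nu> :: 'a fps))) = \<infinity>"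
proof -
  show *: "fps_conv_radius (fps_deriv (bessel_fps \<nu> :: 'a fps)) = \<infinity>"
    using fps_conv_radius_deriv[of "bessel_fps \<nu> :: 'a fps"] assms by simp
  show "fps_conv_radius (fps_deriv (fps_deriv (bessel_fps \<nu> :: 'a fps))) = \<infinity>"
    using fps_conv_radius_deriv[of "fps_deriv (bessel_fps \<nu>) :: 'a fps"] * by simp
qed

lemma bessel_coeff_Suc:
  assumes "\<nu> > 0"
  shows "4 * real (Suc n) * (real n + \<nu> + 1) * bessel_coeff \<nu> (Suc n) = - bessel_coeff \<nu> n"
proof -
  have "pochhammer (\<nu> + 1) n > 0" "\<nu> + 1 + real n > 0"
    using pochhammer_ge_1[of "\<nu> + 1" n] assms by linarith+
  then show ?thesis
    by (simp add: bessel_coeff_def pochhammer_Suc divide_simps) (simp add: algebra_simps)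
qed

text \<open>Bessel's equation in the variable w = z^2; comparing coefficients reduces it to
  \<open>bessel_coeff_Suc\<close>.\<close>

lemma bessel_fps_ode:
  fixes z :: "'a :: {banach, real_normed_field}"
  assumes "\<nu> > 0"
  shows "4 * z * eval_fps (fps_deriv (fps_deriv (bessel_fps \<nu>))) z
    + 4 * (of_real \<nu> + 1) * eval_fps (fps_deriv (bessel_fps \<nu>)) z + eval_fps (bessel_fps \<nu>) z = 0"
proof -
  let ?E = "bessel_fps \<nu> :: 'a fps"
  let ?F = "fps_const 4 * (fps_X * fps_deriv (fps_deriv ?E))
    + fps_const (4 * (of_real \<nu> + 1)) * fps_deriv ?E + ?E"
  have "?F = 0"
  proof (rule fps_ext)
    fix n
    have "fps_nth ?F n =
      of_real (4 * real (Suc n) * (real n + \<nu> + 1) * bessel_coeff \<nu> (Suc n) + bessel_coeff \<nu> n)"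
      by (cases n) (simp_all add: bessel_fps_def algebra_simps)
    also have "\<dots> = 0"
      using bessel_coeff_Suc[OF assms, of n] by simp
    finally show "fps_nth ?F n = fps_nth 0 n" by simp
  qed
  \<comment> \<open>Evaluation commutes with sums and products only inside the radii of convergence,
    so each subexpression is first shown to be entire.\<close>
  have r1: "fps_conv_radius (fps_X * fps_deriv (fps_deriv ?E)) = \<infinity>"
    using fps_conv_radius_mult[of fps_X "fps_deriv (fps_deriv ?E)"] assms by simp
  have r2: "fps_conv_radius (fps_const 4 * (fps_X * fps_deriv (fps_deriv ?E))) = \<infinity>"
    using fps_conv_radius_mult[of "fps_const 4" "fps_X * fps_deriv (fps_deriv ?E)"] r1 by simp
  have r3: "fps_conv_radius (fps_const (4 * (of_real \<nu> + 1)) * fps_deriv ?E) = \<infinity>"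
    using fps_conv_radius_mult[of "fps_const (4 * (of_real \<nu> + 1))" "fps_deriv ?E"] assms by simp
  have r4: "fps_conv_radius (fps_const 4 * (fps_X * fps_deriv (fps_deriv ?E))
      + fps_const (4 * (of_real \<nu> + 1)) * fps_deriv ?E) = \<infinity>"
    using fps_conv_radius_add[of "fps_const 4 * (fps_X * fps_deriv (fps_deriv ?E))"
        "fps_const (4 * (of_real \<nu> + 1)) * fps_deriv ?E"] r2 r3 by simp
  have "0 = eval_fps ?F z"
    using \<open>?F = 0\<close> by simp
  also have "\<dots> = 4 * (z * eval_fps (fps_deriv (fps_deriv ?E)) z)
      + 4 * (of_real \<nu> + 1) * eval_fps (fps_deriv ?E) z + eval_fps ?E z"
    using assms r1 r2 r3 r4 by (simp add: eval_fps_add eval_fps_mult del: mult_numeral_left_semiring_numeral)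
  finally show ?thesis
    by (simp add: mult.assoc)
qed

lemma bessel_E_0 [simp]: "bessel_E \<nu> 0 = 1"
  by (simp add: bessel_E_def eval_fps_at_0 bessel_fps_def bessel_coeff_def)

lemma bessel_L_0 [simp]: "bessel_L \<nu> 0 = 0"
  by (simp add: bessel_L_def bessel_E'_def)

lemma has_field_derivative_bessel_E:
  "(bessel_E \<nu> has_field_derivative bessel_E' \<nu> z) (at z within A)" if "\<nu> > 0"
  unfolding bessel_E_def[abs_def] bessel_E'_def
  by (rule derivative_eq_intros has_field_derivative_eval_fps' | simp add: that)+

lemma has_field_derivative_bessel_L:
  assumes "\<nu> > 0" "bessel_E \<nu> z \<noteq> 0"
  shows "(bessel_L \<nu> has_field_derivative bessel_L' \<nu> z) (at z within A)"
proof -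
  let ?D = "2 * eval_fps (fps_deriv (bessel_fps \<nu>)) (z\<^sup>2)
        + 4 * z\<^sup>2 * eval_fps (fps_deriv (fps_deriv (bessel_fps \<nu>))) (z\<^sup>2)"
  have "(bessel_E' \<nu> has_field_derivative ?D) (at z within A)"
    unfolding bessel_E'_def[abs_def]
    by (rule derivative_eq_intros has_field_derivative_eval_fps' | 
        simp add: assms power2_eq_square)+
  from DERIV_divide[OF DERIV_minus[OF this] has_field_derivative_bessel_E[OF assms(1)] assms(2)]
  show ?thesis
    unfolding bessel_L_def[abs_def] bessel_L'_def
    by (rule DERIV_cong) (use assms(2) in \<open>simp add: divide_simps power2_eq_square\<close>)
qed

text \<open>In terms of e, Bessel's equation is z e'' + (2 \<nu> + 1) e' + z e = 0; dividing by e
  makes it first order in L.\<close>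

lemma bessel_L_riccati:
  fixes z :: "'a :: {banach, real_normed_field}"
  assumes "\<nu> > 0" "bessel_E \<nu> z \<noteq> 0"
  shows "z * bessel_L' \<nu> z = z - (2 * of_real \<nu> + 1) * bessel_L \<nu> z + z * (bessel_L \<nu> z)\<^sup>2"
proof -
  define e where "e = bessel_E \<nu> z"
  define d where "d = eval_fps (fps_deriv (bessel_fps \<nu>)) (z\<^sup>2)"
  define d2 where "d2 = eval_fps (fps_deriv (fps_deriv (bessel_fps \<nu>))) (z\<^sup>2)"
  have e: "e = - (4 * z\<^sup>2 * d2 + 4 * (of_real \<nu> + 1) * d)"
    using minus_unique[OF bessel_fps_ode[OF assms(1), of "z\<^sup>2"]]
    by (simp add: e_def d_def d2_def bessel_E_def)
  have "z * (- (2 * d + 4 * z\<^sup>2 * d2)) = z * e + (2 * of_real \<nu> + 1) * (2 * z * d)"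
    unfolding e by (simp add: algebra_simps)
  moreover have "e \<noteq> 0"
    using assms by (simp add: e_def)
  ultimately have "z * (- (2 * d + 4 * z\<^sup>2 * d2) / e) = z + (2 * of_real \<nu> + 1) * (2 * z * d / e)"
    by (simp add: field_simps)
  then show ?thesis
    by (simp add: bessel_L'_def bessel_L_def bessel_E'_def algebra_simps flip: e_def d_def d2_def)
qed

section \<open>Compatibility of the real and complex versions\<close>

lemma bessel_E_of_real:
  "bessel_E \<nu> (of_real x :: complex) = of_real (bessel_E \<nu> x)" if "\<nu> > 0"
proof -
  have "summable (\<lambda>n. bessel_coeff \<nu> n * (x ^ 2) ^ n)"
    using summable_fps[of "x\<^sup>2" "bessel_fps \<nu>"] fps_conv_radius_bessel_fps[OF that, where 'a = real]
    by (simp add: bessel_fps_def)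
  from suminf_of_real[OF this, where 'a = complex] show ?thesis
    by (simp add: bessel_E_def eval_fps_def bessel_fps_def)
qed

lemma bessel_E'_of_real:
  "bessel_E' \<nu> (of_real x :: complex) = of_real (bessel_E' \<nu> x)" if "\<nu> > 0"
proof -
  have "summable (\<lambda>n. (1 + real n) * bessel_coeff \<nu> (Suc n) * (x ^ 2) ^ n)"
    using summable_fps[of "x\<^sup>2" "fps_deriv (bessel_fps \<nu>)"]
      fps_conv_radius_deriv_bessel_fps(1)[OF that, where 'a = real]
    by (simp add: bessel_fps_def)
  from suminf_of_real[OF this, where 'a = complex] show ?thesis
    by (simp add: bessel_E'_def eval_fps_def bessel_fps_def)
qed

lemma bessel_L_of_real:
  "bessel_L \<nu> (of_real x :: complex) = of_real (bessel_L \<nu> x)" if "\<nu> > 0"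
  using that by (simp add: bessel_L_def bessel_E_of_real bessel_E'_of_real)

section \<open>Nonnegativity of the Taylor coefficients\<close>

lemma sums_Re_eval_fps:
  fixes F :: "complex fps"
  assumes "ereal \<bar>x\<bar> < fps_conv_radius F"
  shows "(\<lambda>n. Re (fps_nth F n) * x ^ n) sums Re (eval_fps F (of_real x))"
proof -
  have "(\<lambda>n. fps_nth F n * of_real x ^ n) sums eval_fps F (of_real x)"
    unfolding eval_fps_def using assms by (intro summable_sums summable_fps) auto
  from sums_Re[OF this] show ?thesis
    by (simp flip: of_real_power)
qed

text \<open>Majorant principle: with nonnegative coefficients the triangle inequality, applied
  termwise, bounds the sum by its value at the modulus.\<close>

lemma norm_eval_fps_le:
  fixes F :: "complex fps"
  assumes "\<And>n. fps_nth F n \<in> \<real>\<^sub>\<ge>\<^sub>0" "ereal (norm z) < fps_conv_radius F"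
  shows "norm (eval_fps F z) \<le> Re (eval_fps F (of_real (norm z)))"
proof -
  have sums: "(\<lambda>n. Re (fps_nth F n) * norm z ^ n) sums Re (eval_fps F (of_real (norm z)))"
    using assms by (intro sums_Re_eval_fps) auto
  have "norm (fps_nth F n * z ^ n) = Re (fps_nth F n) * norm z ^ n" for n
    using assms(1)[of n] by (auto simp: norm_mult norm_power complex_nonneg_Reals_iff cmod_eq_Re)
  with sums show ?thesis
    unfolding eval_fps_def[of F z] using summable_norm[of "\<lambda>n. fps_nth F n * z ^ n"]
    by (simp add: sums_iff)
qed

lemma Re_eval_fps_mono:
  fixes F :: "complex fps"
  assumes "\<And>n. fps_nth F n \<in> \<real>\<^sub>\<ge>\<^sub>0" "0 \<le> x" "x \<le> y" "ereal y < fps_conv_radius F"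
  shows "Re (eval_fps F (of_real x)) \<le> Re (eval_fps F (of_real y))"
proof (rule sums_le)
  have "ereal x < fps_conv_radius F"
    using assms(3,4) by (meson ereal_less_eq(3) le_less_trans)
  then show "(\<lambda>n. Re (fps_nth F n) * x ^ n) sums Re (eval_fps F (of_real x))"
    using assms by (intro sums_Re_eval_fps) auto
  show "(\<lambda>n. Re (fps_nth F n) * y ^ n) sums Re (eval_fps F (of_real y))"
    using assms by (intro sums_Re_eval_fps) auto
  show "Re (fps_nth F n) * x ^ n \<le> Re (fps_nth F n) * y ^ n" for n
    using assms(1)[of n] assms by (auto intro!: mult_left_mono power_mono simp: complex_nonneg_Reals_iff)
qed

lemma Re_eval_fps_pos:
  fixes F :: "complex fps"
  assumes "\<And>n. fps_nth F n \<in> \<real>\<^sub>\<ge>\<^sub>0" "Re (fps_nth F k) > 0" "0 < x" "ereal x < fps_conv_radius F"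
  shows "Re (eval_fps F (of_real x)) > 0"
proof -
  have "(\<lambda>n. Re (fps_nth F n) * x ^ n) sums Re (eval_fps F (of_real x))"
    using assms by (intro sums_Re_eval_fps) auto
  moreover have "0 < (\<Sum>n. Re (fps_nth F n) * x ^ n)"
    using calculation assms
    by (intro suminf_pos2[where i = k]) (auto simp: sums_iff complex_nonneg_Reals_iff)
  ultimately show ?thesis by (simp add: sums_iff)
qed

text \<open>Comparing coefficients gives (n + 2 \<nu> + 1) a_n = [n = 1] + (sum of a_i a_(n-1-i)),
  so strong induction yields nonnegativity. Also a_0 = 0 and (2 \<nu> + 2) a_1 = 1.\<close>

lemma fps_riccati_coeffs:
  fixes F :: "complex fps" and \<nu> :: real
  assumes "\<nu> > 0"
    and F: "fps_X * fps_deriv F = fps_X - fps_const (2 * of_real \<nu> + 1) * F + fps_X * F\<^sup>2"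
  shows "fps_nth F n \<in> \<real>\<^sub>\<ge>\<^sub>0" "Re (fps_nth F 1) > 0"
proof -
  \<comment> \<open>The case n = 0 is split off because \<open>n - 1\<close> is truncated
    subtraction.\<close>
  have rec: "(of_real (2 * \<nu> + 1 + real n)) * fps_nth F n =
      (if n = 0 then 0 else (if n = 1 then 1 else 0) + (\<Sum>i=0..n-1. fps_nth F i * fps_nth F (n - 1 - i)))" for n
  proof -
    have "fps_nth (fps_X * fps_deriv F) n =
        fps_nth (fps_X - fps_const (2 * of_real \<nu> + 1) * F + fps_X * F\<^sup>2) n"
      by (simp add: F)
    moreover have "fps_nth (F\<^sup>2) m = (\<Sum>i=0..m. fps_nth F i * fps_nth F (m - i))" for m
      by (simp add: power2_eq_square fps_mult_nth)
    ultimately show ?thesis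
      by (cases n) (auto simp: algebra_simps)
  qed
  have div: "x \<in> \<real>\<^sub>\<ge>\<^sub>0" if "of_real (2 * \<nu> + 1 + real n) * x \<in> \<real>\<^sub>\<ge>\<^sub>0" for x :: complex and n
  proof -
    have p: "2 * \<nu> + 1 + real n > 0" using assms(1) by simp
    have "x = of_real (1 / (2 * \<nu> + 1 + real n)) * (of_real (2 * \<nu> + 1 + real n) * x)"
      using p by (simp only: mult.assoc[symmetric] of_real_mult[symmetric]) simp
    also have "\<dots> \<in> \<real>\<^sub>\<ge>\<^sub>0"
      by (rule nonneg_Reals_mult_I[OF _ that]) (subst nonneg_Reals_of_real_iff, use p in simp)
    finally show ?thesis .
  qed
  show nonneg: "fps_nth F n \<in> \<real>\<^sub>\<ge>\<^sub>0" for n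
  proof (induction n rule: less_induct)
    case (less n)
    have "(\<Sum>i=0..n-1. fps_nth F i * fps_nth F (n - 1 - i)) \<in> \<real>\<^sub>\<ge>\<^sub>0" if "n \<noteq> 0"
    proof -
      have sumI: "sum f A \<in> \<real>\<^sub>\<ge>\<^sub>0" if "\<And>i. i \<in> A \<Longrightarrow> f i \<in> \<real>\<^sub>\<ge>\<^sub>0" for f :: "nat \<Rightarrow> complex" and A
        using that by (auto simp: complex_nonneg_Reals_iff intro!: sum_nonneg sum.neutral)
      show ?thesis
      proof (rule sumI)
        fix i assume "i \<in> {0..n-1}"
        then have "i < n" "n - 1 - i < n" using that by auto
        then show "fps_nth F i * fps_nth F (n - 1 - i) \<in> \<real>\<^sub>\<ge>\<^sub>0"
          by (intro nonneg_Reals_mult_I less.IH)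
      qed
    qed
    then have "of_real (2 * \<nu> + 1 + real n) * fps_nth F n \<in> \<real>\<^sub>\<ge>\<^sub>0"
      unfolding rec by (cases "n = 0"; cases "n = 1") (simp_all add: nonneg_Reals_add_I)
    then show ?case by (rule div)
  qed
  have "fps_nth F 0 = 0"
    using rec[of 0] assms(1) by (simp add: complex_eq_iff)
  then have "of_real (2 * \<nu> + 2) * fps_nth F 1 = 1"
    using rec[of 1] by (simp add: add.commute)
  from arg_cong[OF this, of Re] have "(2 * \<nu> + 2) * Re (fps_nth F 1) = 1"
    by simp
  then show "Re (fps_nth F 1) > 0"
    using assms(1) by (smt (verit) mult_nonneg_nonpos)
qed

section \<open>The Taylor series of L\<close>

definition bessel_L_fps :: "real \<Rightarrow> complex fps" where
  "bessel_L_fps \<nu> = fps_expansion (bessel_L \<nu>) 0"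

text \<open>R need not be maximal: some small R suffices for identities of formal series, and later
  R is the first positive zero.\<close>

definition zero_free_radius :: "real \<Rightarrow> real \<Rightarrow> bool" where
  "zero_free_radius \<nu> R \<longleftrightarrow> \<nu> > 0 \<and> R > 0 \<and> (\<forall>z::complex. norm z < R \<longrightarrow> bessel_E \<nu> z \<noteq> 0)"

text \<open>L is holomorphic where e has no zero, and a Taylor series represents its function on
  every disc of holomorphy. The third claim follows by uniqueness of derivatives.\<close>

lemma bessel_L_fps_props:
  assumes "zero_free_radius \<nu> R"
  shows "ereal R \<le> fps_conv_radius (bessel_L_fps \<nu>)"
    and "norm z < R \<Longrightarrow> eval_fps (bessel_L_fps \<nu>) z = bessel_L \<nu> z"
    and "norm z < R \<Longrightarrow> eval_fps (fps_deriv (bessel_L_fps \<nu>)) z = bessel_L' \<nu> z"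
proof -
  have holo: "bessel_L \<nu> holomorphic_on eball 0 (ereal R)"
    unfolding holomorphic_on_def using assms
    by (auto simp: field_differentiable_def zero_free_radius_def
        intro!: exI has_field_derivative_bessel_L)
  show conv: "ereal R \<le> fps_conv_radius (bessel_L_fps \<nu>)"
    unfolding bessel_L_fps_def by (intro conv_radius_fps_expansion holo)
  have eval: "eval_fps (bessel_L_fps \<nu>) z = bessel_L \<nu> z" if "norm z < R" for z
    unfolding bessel_L_fps_def using that by (subst eval_fps_expansion'[OF holo]) auto
  then show "norm z < R \<Longrightarrow> eval_fps (bessel_L_fps \<nu>) z = bessel_L \<nu> z" .
  assume z: "norm z < R"
  then have "ereal (norm z) < fps_conv_radius (bessel_L_fps \<nu>)"
    using conv by (meson ereal_less_eq(3) less_ereal.simps(1) less_le_trans)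
  then have d: "(eval_fps (bessel_L_fps \<nu>) has_field_derivative eval_fps (fps_deriv (bessel_L_fps \<nu>)) z) (at z)"
    by (rule has_field_derivative_eval_fps)
  have "(bessel_L \<nu> has_field_derivative eval_fps (fps_deriv (bessel_L_fps \<nu>)) z) (at z)"
    by (rule has_field_derivative_transform_within_open[OF d, of "ball 0 R"]) (use z eval in auto)
  then show "eval_fps (fps_deriv (bessel_L_fps \<nu>)) z = bessel_L' \<nu> z"
    using has_field_derivative_bessel_L[of \<nu> z UNIV] assms z
    by (auto simp: zero_free_radius_def intro: DERIV_unique)
qed

lemma continuous_on_bessel_E [continuous_intros]: "\<nu> > 0 \<Longrightarrow> continuous_on A (bessel_E \<nu>)"
  by (meson DERIV_continuous continuous_at_imp_continuous_on has_field_derivative_bessel_E)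

lemma ex_zero_free_radius: "\<exists>R. zero_free_radius \<nu> R" if "\<nu> > 0"
proof -
  have "\<forall>\<^sub>F z::complex in nhds 0. bessel_E \<nu> z \<noteq> 0"
  proof (rule eventually_nhds_in_open[of "bessel_E \<nu> -` (- {0})", THEN eventually_mono])
    show "open (bessel_E \<nu> -` (- {0::complex}))"
      using continuous_on_bessel_E[OF that] by (intro open_vimage) auto
  qed auto
  then show ?thesis
    unfolding eventually_nhds_metric zero_free_radius_def using that by (auto simp: dist_norm)
qed

text \<open>Power series that agree near 0 are equal, so the Riccati equation passes from the
  function L to its formal series, where \<open>fps_riccati_coeffs\<close> applies.\<close>

lemma bessel_L_fps_coeffs:
  assumes "\<nu> > 0"
  shows "fps_nth (bessel_L_fps \<nu>) n \<in> \<real>\<^sub>\<ge>\<^sub>0" "Re (fps_nth (bessel_L_fps \<nu>) 1) > 0"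
proof -
  obtain R where R: "zero_free_radius \<nu> R"
    using ex_zero_free_radius[OF assms] by blast
  note P = bessel_L_fps_props[OF R]
  let ?F = "bessel_L_fps \<nu>"
  have conv: "ereal R \<le> fps_conv_radius (fps_deriv ?F)" "ereal R \<le> fps_conv_radius (fps_X * fps_deriv ?F)"
    "ereal R \<le> fps_conv_radius (?F\<^sup>2)" "ereal R \<le> fps_conv_radius (fps_X * ?F\<^sup>2)"
    "ereal R \<le> fps_conv_radius (fps_const (2 * of_real \<nu> + 1) * ?F)"
    "ereal R \<le> fps_conv_radius (fps_X - fps_const (2 * of_real \<nu> + 1) * ?F)"
    "ereal R \<le> fps_conv_radius (fps_X - fps_const (2 * of_real \<nu> + 1) * ?F + fps_X * ?F\<^sup>2)"
  proof -
    show 1: "ereal R \<le> fps_conv_radius (fps_deriv ?F)"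
      using P(1) fps_conv_radius_deriv[of ?F] by (rule order.trans)
    show "ereal R \<le> fps_conv_radius (fps_X * fps_deriv ?F)"
      using 1 by (intro order.trans[OF _ fps_conv_radius_mult]) auto
    show 2: "ereal R \<le> fps_conv_radius (?F\<^sup>2)"
      using P(1) fps_conv_radius_power[of ?F 2] by (rule order.trans)
    show 3: "ereal R \<le> fps_conv_radius (fps_X * ?F\<^sup>2)"
      using 2 by (intro order.trans[OF _ fps_conv_radius_mult]) auto
    show 4: "ereal R \<le> fps_conv_radius (fps_const (2 * of_real \<nu> + 1) * ?F)"
      using P(1) by (intro order.trans[OF _ fps_conv_radius_mult]) auto
    show 5: "ereal R \<le> fps_conv_radius (fps_X - fps_const (2 * of_real \<nu> + 1) * ?F)"
      using 4 by (intro order.trans[OF _ fps_conv_radius_diff]) auto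
    show "ereal R \<le> fps_conv_radius (fps_X - fps_const (2 * of_real \<nu> + 1) * ?F + fps_X * ?F\<^sup>2)"
      using 3 5 by (intro order.trans[OF _ fps_conv_radius_add]) auto
  qed
  have "R > 0" using R by (simp add: zero_free_radius_def)
  have "fps_X * fps_deriv ?F = fps_X - fps_const (2 * of_real \<nu> + 1) * ?F + fps_X * ?F\<^sup>2"
  proof (rule eval_fps_eqD)
    show "0 < fps_conv_radius (fps_X * fps_deriv ?F)"
      using \<open>R > 0\<close> by (intro less_le_trans[OF _ conv(2)]) simp
    show "0 < fps_conv_radius (fps_X - fps_const (2 * of_real \<nu> + 1) * ?F + fps_X * ?F\<^sup>2)"
      using \<open>R > 0\<close> by (intro less_le_trans[OF _ conv(7)]) simp
    have "\<forall>\<^sub>F z in nhds (0::complex). z \<in> ball 0 R"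
      using \<open>R > 0\<close> by (intro eventually_nhds_in_open) auto
    then show "\<forall>\<^sub>F z in nhds 0. eval_fps (fps_X * fps_deriv ?F) z =
        eval_fps (fps_X - fps_const (2 * of_real \<nu> + 1) * ?F + fps_X * ?F\<^sup>2) z"
    proof eventually_elim
      case (elim z)
      then have z: "norm z < R" by simp
      then have lt: "ereal (norm z) < x" if "ereal R \<le> x" for x
        using that by (meson less_ereal.simps(1) less_le_trans)
      show ?case
        using bessel_L_riccati[of \<nu> z] R z P(1) conv
        by (simp add: eval_fps_add eval_fps_diff eval_fps_mult eval_fps_power lt P(2,3)
            zero_free_radius_def)
    qed
  qed
  from fps_riccati_coeffs[OF assms this]
  show "fps_nth ?F n \<in> \<real>\<^sub>\<ge>\<^sub>0" "Re (fps_nth ?F 1) > 0" by blast+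
qed

section \<open>Zeros\<close>

text \<open>Dividing by n + 1 only shrinks the coefficients, and the shift of the index costs a
  constant factor r.\<close>

lemma fps_conv_radius_integral0:
  fixes F :: "'a :: {banach, real_normed_field} fps"
  shows "fps_conv_radius F \<le> fps_conv_radius (fps_integral0 F)"
  unfolding fps_conv_radius_def[of "fps_integral0 F"]
proof (rule conv_radius_geI_ex)
  fix r :: real
  assume r: "0 < r" "ereal r < fps_conv_radius F"
  have "summable (\<lambda>n. r * norm (fps_nth F n * of_real r ^ n))"
    using r by (intro summable_mult norm_summable_fps) auto
  then have "summable (\<lambda>n. fps_nth (fps_integral0 F) (Suc n) * of_real r ^ Suc n)"
  proof (rule summable_comparison_test[rotated], intro exI allI impI)
    fix n
    have "norm (fps_nth F n) * r ^ Suc n / norm (of_nat (Suc n) :: 'a) \<le> norm (fps_nth F n) * r ^ Suc n / 1"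
      using r unfolding norm_of_nat by (intro divide_left_mono) auto
    then show "norm (fps_nth (fps_integral0 F) (Suc n) * of_real r ^ Suc n)
        \<le> r * norm (fps_nth F n * of_real r ^ n)"
      using r by (simp add: fps_integral_def norm_mult norm_power norm_divide norm_inverse divide_simps mult_ac
          del: of_nat_Suc)
  qed
  then have "summable (\<lambda>n. fps_nth (fps_integral0 F) n * of_real r ^ n)"
    by (subst (asm) summable_Suc_iff)
  then show "\<exists>z. norm z = r \<and> summable (\<lambda>n. fps_nth (fps_integral0 F) n * z ^ n)"
    using r by (intro exI[of _ "of_real r"]) auto
qed

text \<open>The branch of - log e that vanishes at 0.\<close>

definition bessel_H_fps :: "real \<Rightarrow> complex fps" where
  "bessel_H_fps \<nu> = fps_integral0 (bessel_L_fps \<nu>)"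

lemma bessel_H_fps_coeffs: "fps_nth (bessel_H_fps \<nu>) n \<in> \<real>\<^sub>\<ge>\<^sub>0" if "\<nu> > 0"
proof (cases n)
  case (Suc m)
  have "fps_nth (bessel_L_fps \<nu>) m * of_real (inverse (real n)) \<in> \<real>\<^sub>\<ge>\<^sub>0"
    by (intro nonneg_Reals_mult_I bessel_L_fps_coeffs that) (subst nonneg_Reals_of_real_iff, simp)
  then show ?thesis
    by (simp add: Suc bessel_H_fps_def fps_integral_def field_simps)
qed (simp add: bessel_H_fps_def fps_integral_def)

lemma conv_radius_bessel_H_fps: "ereal R \<le> fps_conv_radius (bessel_H_fps \<nu>)" if "zero_free_radius \<nu> R"
  unfolding bessel_H_fps_def
  using bessel_L_fps_props(1)[OF that] fps_conv_radius_integral0 by (rule order.trans)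

lemma has_field_derivative_bessel_H:
  assumes "zero_free_radius \<nu> R" "norm z < R"
  shows "(eval_fps (bessel_H_fps \<nu>) has_field_derivative bessel_L \<nu> z) (at z within A)"
proof -
  have "ereal (norm z) < fps_conv_radius (bessel_H_fps \<nu>)"
    using conv_radius_bessel_H_fps[OF assms(1)] assms(2)
    by (meson less_ereal.simps(1) less_le_trans)
  from has_field_derivative_eval_fps[OF this] show ?thesis
    using bessel_L_fps_props(2)[OF assms] by (simp add: bessel_H_fps_def fps_deriv_fps_integral)
qed

text \<open>The product e exp(h) has derivative 0 because h' = L = - e' / e, and it equals 1 at the
  origin.\<close>

lemma bessel_E_eq_exp:
  assumes R: "zero_free_radius \<nu> R" and z: "norm z < R"
  shows "bessel_E \<nu> z = exp (- eval_fps (bessel_H_fps \<nu>) z)"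
proof -
  have \<nu>: "\<nu> > 0" and "R > 0" using R by (auto simp: zero_free_radius_def)
  have "\<exists>c. \<forall>w\<in>ball 0 R. bessel_E \<nu> w * exp (eval_fps (bessel_H_fps \<nu>) w) = c"
  proof (rule has_field_derivative_zero_constant)
    fix w :: complex assume w: "w \<in> ball 0 R"
    then have "bessel_E \<nu> w \<noteq> 0" using R by (simp add: zero_free_radius_def)
    then have eq: "bessel_E' \<nu> w * exp (eval_fps (bessel_H_fps \<nu>) w)
        + exp (eval_fps (bessel_H_fps \<nu>) w) * bessel_L \<nu> w * bessel_E \<nu> w = 0"
      by (simp add: bessel_L_def)
    have "((\<lambda>w. exp (eval_fps (bessel_H_fps \<nu>) w)) has_field_derivative
        exp (eval_fps (bessel_H_fps \<nu>) w) * bessel_L \<nu> w) (at w within ball 0 R)"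
      using w by (intro DERIV_chain2[OF DERIV_exp] has_field_derivative_bessel_H[OF R]) auto
    from DERIV_mult[OF has_field_derivative_bessel_E[OF \<nu>] this] eq
    show "((\<lambda>w. bessel_E \<nu> w * exp (eval_fps (bessel_H_fps \<nu>) w)) has_field_derivative 0)
        (at w within ball 0 R)"
      by (rule DERIV_cong)
  qed auto
  then obtain c where c: "\<And>w. norm w < R \<Longrightarrow> bessel_E \<nu> w * exp (eval_fps (bessel_H_fps \<nu>) w) = c"
    by auto
  have "c = 1"
    using c[of 0] \<open>R > 0\<close> by (simp add: eval_fps_at_0 bessel_H_fps_def fps_integral_def)
  then show ?thesis
    using c[OF z] by (simp add: exp_minus field_simps)
qed

text \<open>Here \<bar>e(z)\<bar> = exp(- Re h(z)), and Re h(z) \<le> \<bar>h(z)\<bar> \<le>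
  h(\<bar>z\<bar>) by the majorant principle.\<close>

lemma norm_bessel_E_ge:
  fixes z :: complex
  assumes R: "zero_free_radius \<nu> R" and z: "norm z < R"
  shows "bessel_E \<nu> (norm z) \<le> norm (bessel_E \<nu> z)"
proof -
  have \<nu>: "\<nu> > 0" using R by (auto simp: zero_free_radius_def)
  let ?h = "eval_fps (bessel_H_fps \<nu>)"
  have "ereal (norm z) < fps_conv_radius (bessel_H_fps \<nu>)"
    using conv_radius_bessel_H_fps[OF R] z by (meson less_ereal.simps(1) less_le_trans)
  then have le: "Re (?h z) \<le> Re (?h (of_real (norm z)))"
    using norm_eval_fps_le[OF bessel_H_fps_coeffs[OF \<nu>], of z] complex_Re_le_cmod[of "?h z"]
    by linarith
  have "bessel_E \<nu> (norm z) \<le> norm (bessel_E \<nu> (of_real (norm z) :: complex))"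
    using \<nu> by (simp add: bessel_E_of_real)
  also have "\<dots> = exp (- Re (?h (of_real (norm z))))"
    using z by (subst bessel_E_eq_exp[OF R]) auto
  also have "exp (- Re (?h (of_real (norm z)))) \<le> exp (- Re (?h z))"
    using le by simp
  also have "\<dots> = norm (bessel_E \<nu> z)"
    using z by (subst bessel_E_eq_exp[OF R]) auto
  finally show ?thesis by simp
qed

lemma bessel_E_pos:
  assumes "\<nu> > 0" "\<And>t. 0 \<le> t \<Longrightarrow> t \<le> x \<Longrightarrow> bessel_E \<nu> (t::real) \<noteq> 0" "0 \<le> x"
  shows "bessel_E \<nu> x > 0"
proof (rule ccontr)
  assume "\<not> ?thesis"
  then have "\<exists>t\<ge>0. t \<le> x \<and> bessel_E \<nu> t = 0"
    using assms by (intro IVT2') (auto intro: continuous_intros)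
  with assms(2) show False by blast
qed

text \<open>
  A complex zero of minimal modulus inside the disc would contradict \<open>\<bar>e(z)\<bar> \<ge> e(\<bar>z\<bar>)\<close>,
  which extends to the boundary of the largest zero-free disc by continuity.
\<close>

lemma zero_free_radiusI:
  assumes "\<nu> > 0" "R > 0" and nz: "\<And>x. 0 \<le> x \<Longrightarrow> x < R \<Longrightarrow> bessel_E \<nu> (x::real) \<noteq> 0"
  shows "zero_free_radius \<nu> R"
proof (rule ccontr)
  assume "\<not> ?thesis"
  then obtain z1 :: complex where z1: "norm z1 < R" "bessel_E \<nu> z1 = 0"
    using assms by (auto simp: zero_free_radius_def)
  \<comment> \<open>The zeros in the closed disc through \<open>z1\<close> form a nonempty compact
    set, so one of least modulus exists.\<close>
  define K where "K = cball 0 (norm z1) \<inter> bessel_E \<nu> -` {0::complex}"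
  have "compact K"
    unfolding K_def using assms
    by (intro compact_Int_closed closed_vimage compact_cball continuous_on_bessel_E) auto
  moreover have "z1 \<in> K" using z1 by (simp add: K_def)
  ultimately obtain z0 where z0: "z0 \<in> K" "\<And>z. z \<in> K \<Longrightarrow> norm z0 \<le> norm z"
    using continuous_attains_inf[of K norm] by (auto intro: continuous_intros)
  define r where "r = norm z0"
  have "r > 0" using z0(1) by (auto simp: K_def r_def)
  have "r < R" using z0(1) z1 by (auto simp: K_def r_def)
  have r: "zero_free_radius \<nu> r"
    unfolding zero_free_radius_def
  proof (intro conjI allI impI notI)
    fix z :: complex assume z: "norm z < r" "bessel_E \<nu> z = 0"
    then have "z \<in> K" using z0(1) by (auto simp: K_def r_def)
    with z0(2) z(1) show False by (force simp: r_def)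
  qed fact+
  have "0 \<le> norm (bessel_E \<nu> z0) - bessel_E \<nu> (norm z0)"
  proof (rule continuous_ge_on_closure[of "ball 0 r" "\<lambda>z. norm (bessel_E \<nu> z) - bessel_E \<nu> (norm z)"])
    show "continuous_on (closure (ball 0 r)) (\<lambda>z::complex. norm (bessel_E \<nu> z) - bessel_E \<nu> (norm z))"
      by (intro continuous_on_diff continuous_on_norm continuous_on_bessel_E[OF assms(1)]
          continuous_on_compose2[OF continuous_on_bessel_E[OF assms(1), of UNIV]] continuous_on_id) auto
    show "z0 \<in> closure (ball 0 r)"
      using \<open>r > 0\<close> by (simp add: r_def)
  qed (use norm_bessel_E_ge[OF r] in auto)
  moreover have "bessel_E \<nu> r > 0"
    using assms \<open>r > 0\<close> \<open>r < R\<close> by (intro bessel_E_pos) auto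
  ultimately show False
    using z0(1) by (auto simp: K_def r_def)
qed

text \<open>
  \<open>bessel_S \<nu> z = \<nu> - z J\<^sub>\<nu>'(z) / J\<^sub>\<nu>(z)\<close>, and the Riccati equation turns \<open>bessel_T \<nu> z\<close> into \<open>z S'(z)\<close>.
\<close>

definition bessel_S :: "real \<Rightarrow> 'a \<Rightarrow> 'a :: {banach, real_normed_field}" where
  "bessel_S \<nu> z = z * bessel_L \<nu> z"

definition bessel_T :: "real \<Rightarrow> 'a \<Rightarrow> 'a :: {banach, real_normed_field}" where
  "bessel_T \<nu> z = z\<^sup>2 - 2 * of_real \<nu> * bessel_S \<nu> z + (bessel_S \<nu> z)\<^sup>2"

lemma bessel_T_eq:
  assumes "\<nu> > 0" "bessel_E \<nu> z \<noteq> 0"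
  shows "bessel_T \<nu> z = z * (bessel_L \<nu> z + z * bessel_L' \<nu> z)"
  unfolding bessel_L_riccati[OF assms] bessel_T_def bessel_S_def
  by (simp add: algebra_simps power2_eq_square)

lemma has_field_derivative_bessel_S:
  assumes "\<nu> > 0" "bessel_E \<nu> z \<noteq> 0"
  shows "(bessel_S \<nu> has_field_derivative bessel_L \<nu> z + z * bessel_L' \<nu> z) (at z within A)"
  unfolding bessel_S_def[abs_def]
  by (auto intro!: derivative_eq_intros has_field_derivative_bessel_L assms)

text \<open>
  With \<open>u = S - \<nu>\<close> the Riccati equation reads \<open>x u' = x\<^sup>2 - \<nu>\<^sup>2 + u\<^sup>2\<close>; if \<open>e\<close> had no zero, then
  \<open>arctan u - ln x\<close> would eventually increase, although \<open>arctan\<close> is bounded.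
\<close>

lemma bessel_E_has_zero:
  assumes "\<nu> > 0"
  shows "\<exists>x>0. bessel_E \<nu> (x::real) = 0"
proof (rule ccontr)
  assume "\<not> ?thesis"
  then have nz: "bessel_E \<nu> x \<noteq> 0" if "x > 0" for x :: real
    using that by auto
  define \<phi> where "\<phi> = (\<lambda>x. arctan (bessel_S \<nu> x - \<nu>) - ln x)"
  \<comment> \<open>From x \<ge> \<nu> + 1 on, x^2 - \<nu>^2 \<ge> 1, hence x u' \<ge> 1 + u^2. Over
    this interval ln grows by 4, more than the length \<pi> of the range of arctan.\<close>
  have "\<phi> (\<nu> + 1) \<le> \<phi> ((\<nu> + 1) * exp 4)"
  proof (rule DERIV_nonneg_imp_nondecreasing[where f = \<phi>])
    have "(\<nu> + 1) * 1 \<le> (\<nu> + 1) * exp 4"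
      using assms by (intro mult_left_mono) auto
    then show "\<nu> + 1 \<le> (\<nu> + 1) * exp 4" by simp
  next
    fix x assume x: "\<nu> + 1 \<le> x" "x \<le> (\<nu> + 1) * exp 4"
    define u where "u = bessel_S \<nu> x - \<nu>"
    have "x > 0" using x assms by simp
    have "(\<phi> has_real_derivative (bessel_L \<nu> x + x * bessel_L' \<nu> x) / (1 + u\<^sup>2) - 1 / x) (at x)"
      unfolding \<phi>_def u_def using \<open>x > 0\<close>
      by (auto intro!: derivative_eq_intros has_field_derivative_bessel_S[OF assms] nz simp: field_simps)
    moreover have "1 / x \<le> (bessel_L \<nu> x + x * bessel_L' \<nu> x) / (1 + u\<^sup>2)"
    proof -
      have "(\<nu> + 1)\<^sup>2 \<le> x\<^sup>2"
        using x assms by (intro power_mono) auto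
      then have "1 + u\<^sup>2 \<le> bessel_T \<nu> x"
        using assms by (simp add: bessel_T_def u_def power2_eq_square algebra_simps)
      also have "\<dots> = x * (bessel_L \<nu> x + x * bessel_L' \<nu> x)"
        using \<open>x > 0\<close> by (intro bessel_T_eq assms nz)
      finally show ?thesis
        using \<open>x > 0\<close> by (simp add: field_simps add_pos_nonneg)
    qed
    ultimately show "\<exists>y. (\<phi> has_real_derivative y) (at x) \<and> 0 \<le> y"
      by (intro exI[of _ "(bessel_L \<nu> x + x * bessel_L' \<nu> x) / (1 + u\<^sup>2) - 1 / x"]) auto
  qed
  then have "4 \<le> arctan (bessel_S \<nu> ((\<nu> + 1) * exp 4) - \<nu>) - arctan (bessel_S \<nu> (\<nu> + 1) - \<nu>)"
    using assms by (simp add: \<phi>_def ln_mult)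
  moreover have "arctan (bessel_S \<nu> ((\<nu> + 1) * exp 4) - \<nu>) < pi / 2"
    "- (pi / 2) < arctan (bessel_S \<nu> (\<nu> + 1) - \<nu>)"
    using arctan_bounded by blast+
  ultimately show False
    using pi_less_4 by linarith
qed

text \<open>The zeros in a compact interval have a minimum, which is not 0 because e(0) = 1.\<close>

lemma bessel_E_first_zero:
  assumes "\<nu> > 0"
  shows "\<exists>j::real. j > 0 \<and> bessel_E \<nu> j = 0 \<and> (\<forall>x. 0 \<le> x \<longrightarrow> x < j \<longrightarrow> bessel_E \<nu> x \<noteq> 0)"
proof -
  obtain x1 :: real where x1: "x1 > 0" "bessel_E \<nu> x1 = 0"
    using bessel_E_has_zero[OF assms] by blast
  define K where "K = {0..x1} \<inter> bessel_E \<nu> -` {0::real}"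
  have "compact K"
    unfolding K_def using assms
    by (intro compact_Int_closed closed_vimage continuous_on_bessel_E) auto
  moreover have "x1 \<in> K" using x1 by (simp add: K_def)
  ultimately obtain j where j: "j \<in> K" "\<And>x. x \<in> K \<Longrightarrow> j \<le> x"
    using continuous_attains_inf[of K "\<lambda>x. x"] by (auto intro: continuous_intros)
  show ?thesis
  proof (intro exI conjI allI impI)
    show "j > 0" using j(1) by (cases "j = 0") (auto simp: K_def)
    show "bessel_E \<nu> j = 0" using j(1) by (simp add: K_def)
    show "bessel_E \<nu> x \<noteq> 0" if "0 \<le> x" "x < j" for x
      using j(2)[of x] j(1) that by (auto simp: K_def)
  qed
qed

lemma bessel_S_of_real: "bessel_S \<nu> (of_real x :: complex) = of_real (bessel_S \<nu> x)" if "\<nu> > 0"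
  by (simp add: bessel_S_def bessel_L_of_real that)

lemma bessel_T_of_real: "bessel_T \<nu> (of_real x :: complex) = of_real (bessel_T \<nu> x)" if "\<nu> > 0"
  by (simp add: bessel_T_def bessel_S_of_real that)

lemma bessel_S_0 [simp]: "bessel_S \<nu> 0 = 0"
  by (simp add: bessel_S_def)

lemma bessel_T_0 [simp]: "bessel_T \<nu> 0 = 0"
  by (simp add: bessel_T_def)

section \<open>Majorants and monotonicity of S and T on a zero-free disc\<close>

context
  fixes \<nu> R :: real
  assumes R: "zero_free_radius \<nu> R"
begin

private lemma \<nu>: "\<nu> > 0"
  using R by (simp add: zero_free_radius_def)

private lemma conv: "x < R \<Longrightarrow> ereal x < fps_conv_radius (bessel_L_fps \<nu>)"
  "x < R \<Longrightarrow> ereal x < fps_conv_radius (fps_deriv (bessel_L_fps \<nu>))"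
  using bessel_L_fps_props(1)[OF R] fps_conv_radius_deriv[of "bessel_L_fps \<nu>"]
  by (meson less_ereal.simps(1) less_le_trans)+

text \<open>L' on the real axis, read off from the complex series so that the signs of its
  coefficients can be used.\<close>

private definition M :: "real \<Rightarrow> real" where
  "M x = Re (eval_fps (fps_deriv (bessel_L_fps \<nu>)) (of_real x))"

private lemma deriv_coeffs: "fps_nth (fps_deriv (bessel_L_fps \<nu>)) n \<in> \<real>\<^sub>\<ge>\<^sub>0"
proof -
  have "of_nat (Suc n) * fps_nth (bessel_L_fps \<nu>) (Suc n) \<in> \<real>\<^sub>\<ge>\<^sub>0"
    by (intro nonneg_Reals_mult_I bessel_L_fps_coeffs \<nu>) auto
  then show ?thesis by simp
qed

lemma bessel_E_real_nonzero: "\<bar>x\<bar> < R \<Longrightarrow> bessel_E \<nu> (x::real) \<noteq> 0"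
  using R bessel_E_of_real[OF \<nu>, of x] by (force simp: zero_free_radius_def)

private lemma L_eq: "bessel_L \<nu> x = Re (eval_fps (bessel_L_fps \<nu>) (of_real x))" if "\<bar>x\<bar> < R"
  using that \<nu> by (simp add: bessel_L_fps_props(2)[OF R] bessel_L_of_real)

private lemma T_eq: "bessel_T \<nu> x = x * (bessel_L \<nu> x + x * M x)" if "\<bar>x\<bar> < R" for x :: real
proof -
  have "bessel_E \<nu> (of_real x :: complex) \<noteq> 0"
    using that R by (simp add: zero_free_radius_def)
  note nz = this
  have "bessel_T \<nu> x = Re (bessel_T \<nu> (of_real x))"
    by (simp add: bessel_T_of_real \<nu>)
  also have "\<dots> = Re (of_real x * (bessel_L \<nu> (of_real x) + of_real x * bessel_L' \<nu> (of_real x)))"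
    by (simp only: bessel_T_eq[OF \<nu> nz])
  also have "\<dots> = x * (bessel_L \<nu> x + x * M x)"
    using that \<nu> by (simp add: bessel_L_of_real M_def bessel_L_fps_props(3)[OF R])
  finally show ?thesis .
qed

private lemma norm_L: "norm (bessel_L \<nu> z) \<le> bessel_L \<nu> (norm z)" if "norm z < R" for z :: complex
  using norm_eval_fps_le[of "bessel_L_fps \<nu>" z] bessel_L_fps_coeffs[OF \<nu>] conv(1)[OF that] that
  by (simp add: L_eq bessel_L_fps_props(2)[OF R])

private lemma norm_L': "norm (bessel_L' \<nu> z) \<le> M (norm z)" if "norm z < R" for z :: complex
  using norm_eval_fps_le[of "fps_deriv (bessel_L_fps \<nu>)" z, OF deriv_coeffs conv(2)[OF that]] that
  by (simp add: M_def bessel_L_fps_props(3)[OF R])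

lemma norm_bessel_S_le:
  fixes z :: complex
  assumes "norm z < R"
  shows "norm (bessel_S \<nu> z) \<le> bessel_S \<nu> (norm z)"
  unfolding bessel_S_def norm_mult using norm_L[OF assms] by (rule mult_left_mono) auto

text \<open>The definition of T contains a negative term; the form z (L + z L') has only nonnegative
  coefficients and gives the bound.\<close>

lemma norm_bessel_T_le:
  fixes z :: complex
  assumes z: "norm z < R"
  shows "norm (bessel_T \<nu> z) \<le> bessel_T \<nu> (norm z)"
proof -
  have "norm (bessel_L \<nu> z + z * bessel_L' \<nu> z) \<le> norm (bessel_L \<nu> z) + norm z * norm (bessel_L' \<nu> z)"
    by (metis norm_mult norm_triangle_ineq)
  also have "\<dots> \<le> bessel_L \<nu> (norm z) + norm z * M (norm z)"
    using norm_L[OF z] norm_L'[OF z] by (intro add_mono mult_left_mono) auto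
  finally have "norm z * norm (bessel_L \<nu> z + z * bessel_L' \<nu> z)
      \<le> norm z * (bessel_L \<nu> (norm z) + norm z * M (norm z))"
    by (rule mult_left_mono) auto
  moreover have "bessel_T \<nu> z = z * (bessel_L \<nu> z + z * bessel_L' \<nu> z)"
    using R z by (intro bessel_T_eq) (auto simp: zero_free_radius_def)
  ultimately show ?thesis
    using z by (simp add: T_eq norm_mult)
qed

private lemma L_mono: "0 \<le> x \<Longrightarrow> x \<le> y \<Longrightarrow> y < R \<Longrightarrow> bessel_L \<nu> x \<le> bessel_L \<nu> y"
  using Re_eval_fps_mono[of "bessel_L_fps \<nu>" x y] bessel_L_fps_coeffs[OF \<nu>] conv(1)[of y]
  by (simp add: L_eq)

private lemma M_mono: "0 \<le> x \<Longrightarrow> x \<le> y \<Longrightarrow> y < R \<Longrightarrow> M x \<le> M y"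
  using Re_eval_fps_mono[of "fps_deriv (bessel_L_fps \<nu>)" x y, OF deriv_coeffs] conv(2)[of y]
  by (simp add: M_def)

private lemma L_pos: "0 < x \<Longrightarrow> x < R \<Longrightarrow> bessel_L \<nu> x > 0"
  using Re_eval_fps_pos[of "bessel_L_fps \<nu>" 1 x] bessel_L_fps_coeffs[OF \<nu>] conv(1)[of x]
  by (simp add: L_eq)

private lemma M_nonneg: "0 \<le> x \<Longrightarrow> x < R \<Longrightarrow> M x \<ge> 0"
  using order.trans[OF norm_ge_zero norm_L'[of "of_real x"]] by simp

private lemma L_nonneg: "0 \<le> x \<Longrightarrow> x < R \<Longrightarrow> bessel_L \<nu> x \<ge> 0"
  using L_pos[of x] by (cases "x = 0") auto

text \<open>x L(x) \<le> x L(y) < y L(y); the strict part uses L(y) > 0, which comes from the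
  positive linear coefficient of L.\<close>

lemma bessel_S_strict_mono: "0 \<le> x \<Longrightarrow> x < y \<Longrightarrow> y < R \<Longrightarrow> bessel_S \<nu> x < bessel_S \<nu> y"
  unfolding bessel_S_def
  by (rule le_less_trans[of _ "x * bessel_L \<nu> y"])
    (use L_mono[of x y] L_pos[of y] in \<open>auto intro: mult_left_mono mult_strict_right_mono\<close>)

lemma bessel_T_pos: "0 < x \<Longrightarrow> x < R \<Longrightarrow> bessel_T \<nu> x > 0"
  using L_pos[of x] M_nonneg[of x] by (simp add: T_eq add_pos_nonneg)

lemma bessel_T_mono: "0 \<le> x \<Longrightarrow> x \<le> y \<Longrightarrow> y < R \<Longrightarrow> bessel_T \<nu> x \<le> bessel_T \<nu> y"
  using L_mono[of x y] M_mono[of x y] M_nonneg[of x] L_nonneg[of x]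
  by (simp add: T_eq mult_mono add_mono)

end

section \<open>Relation to the Bessel function\<close>

lemma Gamma_of_nat_add_real: "Gamma (real n + \<nu> + 1) = pochhammer (\<nu> + 1) n * Gamma (\<nu> + 1)"
  if "\<nu> > 0" for \<nu> :: real
proof -
  have "\<nu> + 1 \<notin> \<int>\<^sub>\<le>\<^sub>0" using that by (auto elim!: nonpos_Ints_cases)
  moreover have "Gamma (\<nu> + 1) > 0" using that by (intro Gamma_real_pos) auto
  ultimately show ?thesis
    using pochhammer_Gamma[of "\<nu> + 1" n] by (simp add: field_simps add_ac)
qed

lemma bessel_E_sums:
  fixes z :: "'a :: {banach, real_normed_field}"
  assumes "\<nu> > 0"
  shows "(\<lambda>n. of_real (bessel_coeff \<nu> n) * z ^ (2 * n)) sums bessel_E \<nu> z"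
proof -
  have "(\<lambda>n. fps_nth (bessel_fps \<nu>) n * (z\<^sup>2) ^ n) sums bessel_E \<nu> z"
    unfolding bessel_E_def eval_fps_def using assms by (intro summable_sums summable_fps) simp
  then show ?thesis
    by (simp add: bessel_fps_def power_mult)
qed

text \<open>At x = 0 both sides vanish since \<open>0 powr a = 0\<close>; this point is the left end
  of the interval in the later use of Rolle's theorem.\<close>

lemma bessel_J_eq_real:
  assumes "\<nu> > 0" "x \<ge> 0"
  shows "bessel_J \<nu> x = (x / 2) powr \<nu> / Gamma (\<nu> + 1) * bessel_E \<nu> x"
proof (cases "x = 0")
  case True
  then show ?thesis by (simp add: bessel_J_def)
next
  case False
  have "(- 1) ^ n / (fact n * Gamma (real n + \<nu> + 1)) * (x / 2) powr (real (2 * n) + \<nu>) =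
     (x / 2) powr \<nu> / Gamma (\<nu> + 1) * (bessel_coeff \<nu> n * x ^ (2 * n))" for n
  proof -
    have "(x / 2) powr real (2 * n) = x ^ (2 * n) / 4 ^ n"
      using False assms(2) by (subst powr_realpow) (auto simp: power_divide power_mult)
    then show ?thesis
      using assms by (simp add: powr_add Gamma_of_nat_add_real bessel_coeff_def mult_ac)
  qed
  then show ?thesis
    using sums_mult[OF bessel_E_sums[OF assms(1), of x], of "(x / 2) powr \<nu> / Gamma (\<nu> + 1)"]
    by (simp add: bessel_J_def sums_iff)
qed

text \<open>All powers have the base z / 2 and hence use the same logarithm, so the factor
  (z/2)^\<nu> comes out even on the branch cut.\<close>

lemma bessel_J_eq_complex:
  fixes z :: complex
  assumes "\<nu> > 0" "z \<noteq> 0"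
  shows "bessel_J (of_real \<nu>) z = (z / 2) powr of_real \<nu> / Gamma (of_real \<nu> + 1) * bessel_E \<nu> z"
proof -
  have "(- 1) ^ n / (fact n * Gamma (of_nat n + of_real \<nu> + 1)) * (z / 2) powr (of_nat (2 * n) + of_real \<nu>) =
     (z / 2) powr of_real \<nu> / Gamma (of_real \<nu> + 1) * (of_real (bessel_coeff \<nu> n) * z ^ (2 * n))" for n
  proof -
    have "(z / 2) powr of_nat (2 * n) = z ^ (2 * n) / 4 ^ n"
      using assms(2) by (subst powr_nat') (auto simp: power_divide power_mult)
    moreover have "Gamma (of_nat n + of_real \<nu> + 1) =
        of_real (pochhammer (\<nu> + 1) n) * Gamma (of_real \<nu> + 1 :: complex)"
      using arg_cong[OF Gamma_of_nat_add_real[OF assms(1), of n], of complex_of_real]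
      by (simp flip: Gamma_complex_of_real)
    ultimately show ?thesis
      using assms(2) by (simp add: powr_add bessel_coeff_def mult_ac)
  qed
  then show ?thesis
    using sums_mult[OF bessel_E_sums[OF assms(1), of z], of "(z / 2) powr of_real \<nu> / Gamma (of_real \<nu> + 1)"]
    by (simp add: bessel_J_def sums_iff)
qed

lemma Gamma_plus1_neq_0: "Gamma (\<nu> + 1) \<noteq> 0" if "\<nu> > 0" for \<nu> :: real
  using Gamma_real_pos[of "\<nu> + 1"] that by linarith

lemma has_field_derivative_bessel_J:
  assumes "\<nu> > 0" "x > 0"
  shows "(bessel_J \<nu> has_field_derivative
    (x / 2) powr \<nu> / Gamma (\<nu> + 1) * (\<nu> * bessel_E \<nu> x + x * bessel_E' \<nu> x) / x) (at x)"
proof -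
  have "((\<lambda>x. (x / 2) powr \<nu> / Gamma (\<nu> + 1) * bessel_E \<nu> x) has_field_derivative
      \<nu> * (x / 2) powr (\<nu> - 1) / 2 / Gamma (\<nu> + 1) * bessel_E \<nu> x
      + (x / 2) powr \<nu> / Gamma (\<nu> + 1) * bessel_E' \<nu> x) (at x)"
    using assms Gamma_plus1_neq_0[OF assms(1)]
    by (auto intro!: derivative_eq_intros has_field_derivative_bessel_E simp: field_simps)
  then have "((\<lambda>x. (x / 2) powr \<nu> / Gamma (\<nu> + 1) * bessel_E \<nu> x) has_field_derivative
      (x / 2) powr \<nu> / Gamma (\<nu> + 1) * (\<nu> * bessel_E \<nu> x + x * bessel_E' \<nu> x) / x) (at x)"
  proof (rule DERIV_cong)
    have "(x / 2) powr (\<nu> - 1) = (x / 2) powr \<nu> * 2 / x"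
      using assms by (simp add: powr_diff)
    then show "\<nu> * (x / 2) powr (\<nu> - 1) / 2 / Gamma (\<nu> + 1) * bessel_E \<nu> x
        + (x / 2) powr \<nu> / Gamma (\<nu> + 1) * bessel_E' \<nu> x =
      (x / 2) powr \<nu> / Gamma (\<nu> + 1) * (\<nu> * bessel_E \<nu> x + x * bessel_E' \<nu> x) / x"
      using assms by (simp add: distrib_left add_divide_distrib mult_ac)
  qed
  then show ?thesis
    by (rule has_field_derivative_transform_within_open[of _ _ _ "{0<..}"])
      (use assms in \<open>auto simp: bessel_J_eq_real\<close>)
qed

text \<open>Logarithmic differentiation: x J' / J = \<nu> + x e' / e = \<nu> - S. Zeros of J' thus
  become solutions of S = \<nu>.\<close>

lemma deriv_bessel_J:
  assumes "\<nu> > 0" "x > 0" "bessel_E \<nu> x \<noteq> 0"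
  shows "x * deriv (bessel_J \<nu>) x = (\<nu> - bessel_S \<nu> x) * bessel_J \<nu> x"
proof -
  define P where "P = (x / 2) powr \<nu> / Gamma (\<nu> + 1)"
  have "x * bessel_E' \<nu> x = - bessel_S \<nu> x * bessel_E \<nu> x"
    using assms by (simp add: bessel_S_def bessel_L_def)
  moreover have "x * deriv (bessel_J \<nu>) x = P * (\<nu> * bessel_E \<nu> x + x * bessel_E' \<nu> x)"
    using assms DERIV_imp_deriv[OF has_field_derivative_bessel_J[OF assms(1,2)]] by (simp add: P_def)
  moreover have "bessel_J \<nu> x = P * bessel_E \<nu> x"
    using assms by (simp add: bessel_J_eq_real P_def)
  ultimately show ?thesis
    by (simp add: algebra_simps)
qed

lemma bessel_J_eq_0_iff: "bessel_J \<nu> x = 0 \<longleftrightarrow> bessel_E \<nu> x = 0" if "\<nu> > 0" "x > 0"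
  using that Gamma_plus1_neq_0[OF that(1)] by (simp add: bessel_J_eq_real)

text \<open>The expansion depends only on the germ at 0. There h is small, so the principal root of
  e = exp(- h) is exp(- h / \<nu>), an expression holomorphic on every zero-free disc.\<close>

lemma bessel_f_eq:
  assumes "\<nu> > 0"
  shows "bessel_f \<nu> = fps_expansion (\<lambda>z. z * exp (- eval_fps (bessel_H_fps \<nu>) z / of_real \<nu>)) 0"
  unfolding bessel_f_def
proof (rule fps_expansion_cong)
  let ?H = "eval_fps (bessel_H_fps \<nu>)"
  obtain R where R: "zero_free_radius \<nu> R"
    using ex_zero_free_radius[OF assms] by blast
  then have "R > 0" by (simp add: zero_free_radius_def)
  have "?H 0 = 0"
    by (simp add: eval_fps_at_0 bessel_H_fps_def fps_integral_def)
  moreover have "isCont ?H 0"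
    using has_field_derivative_bessel_H[OF R, of 0] \<open>R > 0\<close> by (auto intro: DERIV_isCont)
  ultimately have "(?H \<longlongrightarrow> 0) (nhds 0)"
    by (metis isCont_def tendsto_at_iff_tendsto_nhds)
  then have "\<forall>\<^sub>F z in nhds 0. dist (?H z) 0 < pi"
    by (rule tendstoD) simp
  moreover have "\<forall>\<^sub>F z in nhds (0::complex). z \<in> ball 0 R"
    using \<open>R > 0\<close> by (intro eventually_nhds_in_open) auto
  ultimately show "\<forall>\<^sub>F z in nhds 0.
      z * (2 powr of_real \<nu> * Gamma (of_real \<nu> + 1) * z powr (- of_real \<nu>) * bessel_J (of_real \<nu>) z)
        powr (1 / of_real \<nu>) = z * exp (- ?H z / of_real \<nu>)"
  proof eventually_elim
    case (elim z)
    show ?case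
    proof (cases "z = 0")
      case False
      \<comment> \<open>The logarithms differ by a real constant, so the principal powers cancel for
        every z \<noteq> 0, on the cut as well.\<close>
      have "Ln (z / 2) = Ln z - Ln 2"
        using False Ln_divide_of_real[of 2 z] Ln_of_real[of 2] by auto
      then have "2 powr of_real \<nu> * z powr (- of_real \<nu>) * (z / 2) powr of_real \<nu> = 1"
        using False by (simp add: powr_def right_diff_distrib flip: exp_add)
      moreover have "Gamma (of_real \<nu> + 1 :: complex) \<noteq> 0"
        using Gamma_plus1_neq_0[OF assms] by (metis Gamma_complex_of_real of_real_1 of_real_add of_real_eq_0_iff)
      ultimately have "2 powr of_real \<nu> * Gamma (of_real \<nu> + 1) * z powr (- of_real \<nu>) * bessel_J (of_real \<nu>) z
          = bessel_E \<nu> z"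
        using False assms by (simp add: bessel_J_eq_complex field_simps)
      also have "\<dots> = exp (- ?H z)"
        using elim by (intro bessel_E_eq_exp[OF R]) simp
      finally have *: "2 powr of_real \<nu> * Gamma (of_real \<nu> + 1) * z powr (- of_real \<nu>) * bessel_J (of_real \<nu>) z
          = exp (- ?H z)" .
      \<comment> \<open>In the strip \<bar>Im\<bar> < \<pi>, \<open>Ln\<close> inverts
        \<open>exp\<close>.\<close>
      have "\<bar>Im (?H z)\<bar> < pi"
        using elim abs_Im_le_cmod[of "?H z"] by simp
      then have "Ln (exp (- ?H z)) = - ?H z"
        by (intro Ln_exp) auto
      then show ?thesis
        unfolding * by (simp add: powr_def)
    qed simp
  qed
qed

text \<open>On the disc the series sums to z exp(- h / \<nu>); differentiate with h' = L and z S' =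
  T. The common exponential factor is kept in front because it cancels in z f'' / f'.\<close>

lemma bessel_f_props:
  assumes R: "zero_free_radius \<nu> R"
  shows "ereal R \<le> fps_conv_radius (bessel_f \<nu>)"
    and "norm z < R \<Longrightarrow> deriv (eval_fps (bessel_f \<nu>)) z =
      exp (- eval_fps (bessel_H_fps \<nu>) z / of_real \<nu>) * (1 - bessel_S \<nu> z / of_real \<nu>)"
    and "norm z < R \<Longrightarrow> z * deriv (deriv (eval_fps (bessel_f \<nu>))) z =
      exp (- eval_fps (bessel_H_fps \<nu>) z / of_real \<nu>) *
        (- (bessel_S \<nu> z / of_real \<nu>) * (1 - bessel_S \<nu> z / of_real \<nu>) - bessel_T \<nu> z / of_real \<nu>)"
proof -
  have \<nu>: "\<nu> > 0" and nz: "\<And>z::complex. norm z < R \<Longrightarrow> bessel_E \<nu> z \<noteq> 0"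
    using R by (auto simp: zero_free_radius_def)
  define X where "X = (\<lambda>z. exp (- eval_fps (bessel_H_fps \<nu>) z / of_real \<nu>))"
  define g where "g = (\<lambda>z. z * X z)"
  define g' where "g' = (\<lambda>z. X z * (1 - bessel_S \<nu> z / of_real \<nu>))"
  have X: "(X has_field_derivative X z * (- bessel_L \<nu> z / of_real \<nu>)) (at z)" if "norm z < R" for z
    unfolding X_def
    by (rule DERIV_chain2[OF DERIV_exp DERIV_cdivide[OF DERIV_minus[OF has_field_derivative_bessel_H[OF R that]]]])
  have g: "(g has_field_derivative g' z) (at z)" if "norm z < R" for z
    unfolding g_def
    by (rule DERIV_cong[OF DERIV_mult[OF DERIV_ident X[OF that]]])
      (simp add: g'_def bessel_S_def algebra_simps)
  have g': "(g' has_field_derivative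
      X z * (- bessel_L \<nu> z / of_real \<nu>) * (1 - bessel_S \<nu> z / of_real \<nu>)
      + (0 - (bessel_L \<nu> z + z * bessel_L' \<nu> z) / of_real \<nu>) * X z) (at z)" if "norm z < R" for z
    unfolding g'_def
    by (rule DERIV_mult[OF X[OF that] DERIV_diff[OF DERIV_const
          DERIV_cdivide[OF has_field_derivative_bessel_S[OF \<nu> nz[OF that]]]]])
  have holo: "g holomorphic_on eball 0 (ereal R)"
    unfolding holomorphic_on_def
    unfolding field_differentiable_def using has_field_derivative_at_within[OF g] by fastforce
  have F: "bessel_f \<nu> = fps_expansion g 0"
    by (simp add: bessel_f_eq[OF \<nu>] g_def X_def)
  show "ereal R \<le> fps_conv_radius (bessel_f \<nu>)"
    unfolding F by (rule conv_radius_fps_expansion[OF holo])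
  have eval: "eval_fps (bessel_f \<nu>) z = g z" if "norm z < R" for z
    unfolding F using that by (subst eval_fps_expansion'[OF holo]) auto
  have d: "deriv (eval_fps (bessel_f \<nu>)) z = g' z" if "norm z < R" for z
    by (rule DERIV_imp_deriv, rule has_field_derivative_transform_within_open[OF g[OF that], of "ball 0 R"])
      (use that eval in auto)
  then show "norm z < R \<Longrightarrow> deriv (eval_fps (bessel_f \<nu>)) z =
      exp (- eval_fps (bessel_H_fps \<nu>) z / of_real \<nu>) * (1 - bessel_S \<nu> z / of_real \<nu>)"
    by (simp add: g'_def X_def)
  assume z: "norm z < R"
  have dd: "deriv (deriv (eval_fps (bessel_f \<nu>))) z = X z * (- bessel_L \<nu> z / of_real \<nu>) * (1 - bessel_S \<nu> z / of_real \<nu>)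
      + (0 - (bessel_L \<nu> z + z * bessel_L' \<nu> z) / of_real \<nu>) * X z"
    by (rule DERIV_imp_deriv, rule has_field_derivative_transform_within_open[OF g'[OF z], of "ball 0 R"])
      (use z d in auto)
  have "exp (- eval_fps (bessel_H_fps \<nu>) z / of_real \<nu>) = X z"
    by (simp add: X_def)
  then show "z * deriv (deriv (eval_fps (bessel_f \<nu>))) z =
      exp (- eval_fps (bessel_H_fps \<nu>) z / of_real \<nu>) *
        (- (bessel_S \<nu> z / of_real \<nu>) * (1 - bessel_S \<nu> z / of_real \<nu>) - bessel_T \<nu> z / of_real \<nu>)"
    unfolding dd bessel_T_eq[OF \<nu> nz[OF z]] bessel_S_def
    by (simp only:) (simp add: algebra_simps)
qed

section \<open>The two radii\<close>

text \<open>\<open>bessel_Q \<nu> z\<close> is \<open>- z f''(z) / f'(z)\<close> for \<open>f = f\<^sub>\<nu>\<close>.\<close>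

definition bessel_Q :: "real \<Rightarrow> 'a \<Rightarrow> 'a :: {banach, real_normed_field}" where
  "bessel_Q \<nu> z = bessel_S \<nu> z / of_real \<nu> + bessel_T \<nu> z / (of_real \<nu> - bessel_S \<nu> z)"

lemma bessel_Q_of_real: "bessel_Q \<nu> (of_real x :: complex) = of_real (bessel_Q \<nu> x)" if "\<nu> > 0"
  by (simp add: bessel_Q_def bessel_S_of_real bessel_T_of_real that)

lemma bessel_f_quotient:
  assumes R: "zero_free_radius \<nu> R" and z: "norm z < R" and S: "bessel_S \<nu> z \<noteq> of_real \<nu>"
  shows "deriv (eval_fps (bessel_f \<nu>)) z \<noteq> 0"
    and "z * deriv (deriv (eval_fps (bessel_f \<nu>))) z / deriv (eval_fps (bessel_f \<nu>)) z = - bessel_Q \<nu> z"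
proof -
  have \<nu>: "complex_of_real \<nu> \<noteq> 0"
    using R by (auto simp: zero_free_radius_def)
  have u: "of_real \<nu> - bessel_S \<nu> z \<noteq> 0" using S by simp
  have eq: "1 - bessel_S \<nu> z / of_real \<nu> = (of_real \<nu> - bessel_S \<nu> z) / of_real \<nu>"
    using \<nu> by (simp add: field_simps)
  show "deriv (eval_fps (bessel_f \<nu>)) z \<noteq> 0"
    unfolding bessel_f_props(2)[OF R z] eq using \<nu> u by simp
  have *: "x * (- s * (u / n) - t / n) / (x * (u / n)) = - (s + t / u)"
    if "x \<noteq> 0" "u \<noteq> 0" "n \<noteq> 0" for x s t u n :: complex
    using that by (simp add: divide_simps)
  show "z * deriv (deriv (eval_fps (bessel_f \<nu>))) z / deriv (eval_fps (bessel_f \<nu>)) z = - bessel_Q \<nu> z"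
    unfolding bessel_f_props(2,3)[OF R z] eq bessel_Q_def by (rule *) (use \<nu> u in auto)
qed

text \<open>\<bar>S(z)\<bar> \<le> S(\<bar>z\<bar>) < S(j') = \<nu>; this keeps f' from vanishing in
  the disc of radius j'.\<close>

lemma bessel_S_less:
  fixes z :: complex
  assumes R: "zero_free_radius \<nu> R" and j': "j' < R" "bessel_S \<nu> j' = \<nu>" and z: "norm z < j'"
  shows "bessel_S \<nu> (norm z) < \<nu>" "bessel_S \<nu> z \<noteq> of_real \<nu>"
proof -
  have "\<nu> > 0" using R by (simp add: zero_free_radius_def)
  show less: "bessel_S \<nu> (norm z) < \<nu>"
    using bessel_S_strict_mono[OF R, of "norm z" j'] j' z by simp
  show "bessel_S \<nu> z \<noteq> of_real \<nu>"
    using norm_bessel_S_le[OF R, of z] less j' z \<open>\<nu> > 0\<close> by auto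
qed

text \<open>Numerators are bounded by their majorants, and the denominator satisfies \<bar>\<nu> -
  S(z)\<bar> \<ge> \<nu> - S(\<bar>z\<bar>) > 0.\<close>

lemma norm_bessel_Q_le:
  fixes z :: complex
  assumes R: "zero_free_radius \<nu> R" and j': "j' < R" "bessel_S \<nu> j' = \<nu>" and z: "norm z < j'"
  shows "norm (bessel_Q \<nu> z) \<le> bessel_Q \<nu> (norm z)"
proof -
  have \<nu>: "\<nu> > 0" using R by (simp add: zero_free_radius_def)
  have z': "norm z < R" using z j' by simp
  have "norm (bessel_Q \<nu> z) \<le>
      norm (bessel_S \<nu> z) / \<nu> + norm (bessel_T \<nu> z) / norm (of_real \<nu> - bessel_S \<nu> z)"
    unfolding bessel_Q_def using \<nu> by (metis norm_divide norm_of_real abs_of_pos norm_triangle_ineq)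
  also have "\<dots> \<le> bessel_S \<nu> (norm z) / \<nu> + bessel_T \<nu> (norm z) / (\<nu> - bessel_S \<nu> (norm z))"
  proof (intro add_mono divide_right_mono frac_le)
    have "\<nu> - norm (bessel_S \<nu> z) \<le> norm (of_real \<nu> - bessel_S \<nu> z)"
      using norm_triangle_ineq2[of "of_real \<nu>" "bessel_S \<nu> z"] \<nu> by simp
    then show "\<nu> - bessel_S \<nu> (norm z) \<le> norm (of_real \<nu> - bessel_S \<nu> z)"
      using norm_bessel_S_le[OF R z'] by simp
    show "0 < \<nu> - bessel_S \<nu> (norm z)"
      using bessel_S_less(1)[OF assms] by simp
    show "0 \<le> bessel_T \<nu> (norm z)"
      using norm_bessel_T_le[OF R z'] norm_ge_zero order.trans by blast
  qed (use \<nu> norm_bessel_S_le[OF R z'] norm_bessel_T_le[OF R z'] in auto)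
  finally show ?thesis by (simp add: bessel_Q_def)
qed

text \<open>S / \<nu> increases strictly; in the other summand T does not decrease and the positive
  denominator \<nu> - S decreases.\<close>

lemma bessel_Q_strict_mono:
  assumes R: "zero_free_radius \<nu> R" and j': "j' < R" "bessel_S \<nu> j' = \<nu>" and "0 \<le> x" "x < y" "y < j'"
  shows "bessel_Q \<nu> x < bessel_Q \<nu> (y::real)"
proof -
  have \<nu>: "\<nu> > 0" using R by (simp add: zero_free_radius_def)
  have S: "bessel_S \<nu> x < bessel_S \<nu> y" "bessel_S \<nu> y < \<nu>"
    using bessel_S_strict_mono[OF R, of x y] bessel_S_strict_mono[OF R, of y j'] assms by auto
  have "bessel_T \<nu> x / (\<nu> - bessel_S \<nu> x) \<le> bessel_T \<nu> y / (\<nu> - bessel_S \<nu> y)"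
    using S bessel_T_mono[OF R, of x y] bessel_T_pos[OF R, of y] assms by (intro frac_le) auto
  moreover have "bessel_S \<nu> x / \<nu> < bessel_S \<nu> y / \<nu>"
    using S \<nu> by (simp add: divide_strict_right_mono)
  ultimately show ?thesis by (simp add: bessel_Q_def)
qed

lemma bessel_Q_attains:
  assumes R: "zero_free_radius \<nu> R" and j': "0 < j'" "j' < R" "bessel_S \<nu> j' = \<nu>" and k: "k > 0"
  obtains r where "0 < r" "r < j'" "bessel_Q \<nu> (r::real) = k"
proof -
  have \<nu>: "\<nu> > 0" using R by (simp add: zero_free_radius_def)
  \<comment> \<open>P = \<nu> (\<nu> - S) (Q - k): clearing the denominator removes the singularity
    of Q at j', so the intermediate value theorem applies on the closed interval.\<close>
  define P where "P = (\<lambda>x::real. bessel_S \<nu> x * (\<nu> - bessel_S \<nu> x) + \<nu> * bessel_T \<nu> x - k * \<nu> * (\<nu> - bessel_S \<nu> x))"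
  have contS: "continuous_on {0..j'} (bessel_S \<nu>)"
    by (rule DERIV_continuous_on[OF has_field_derivative_bessel_S[OF \<nu>]])
      (use bessel_E_real_nonzero[OF R] j' in auto)
  have "continuous_on {0..j'} P"
    unfolding P_def bessel_T_def by (intro continuous_intros contS)
  moreover have "P 0 \<le> 0"
    using \<nu> k by (simp add: P_def)
  moreover have Pj: "P j' > 0"
    using bessel_T_pos[OF R, of j'] j' \<nu> by (simp add: P_def)
  ultimately obtain r where r: "0 \<le> r" "r \<le> j'" "P r = 0"
    using IVT'[of P 0 0 j'] j' by auto
  have "r \<noteq> 0" using r \<nu> k by (auto simp: P_def)
  moreover have "r \<noteq> j'" using r Pj by auto
  ultimately have r': "0 < r" "r < j'" using r by auto
  have "\<nu> - bessel_S \<nu> r > 0"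
    using bessel_S_strict_mono[OF R, of r j'] r' j' by simp
  then have "bessel_Q \<nu> r = k"
    using r(3) \<nu> by (simp add: P_def bessel_Q_def field_simps)
  with r' that show thesis by blast
qed

text \<open>The open ball of radius r is admissible, and every larger ball contains the point r,
  where P fails.\<close>

lemma radius_Sup_eq:
  fixes F :: "complex fps" and P :: "complex \<Rightarrow> bool"
  assumes "0 < r" "ereal r < fps_conv_radius F" "\<And>z. norm z < r \<Longrightarrow> P z" "\<not> P (of_real r)"
  shows "Sup {ereal s | s. 0 < s \<and> ereal s < fps_conv_radius F \<and> (\<forall>z\<in>ball 0 s. P z)} = ereal r"
proof (rule antisym)
  show "Sup {ereal s | s. 0 < s \<and> ereal s < fps_conv_radius F \<and> (\<forall>z\<in>ball 0 s. P z)} \<le> ereal r"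
  proof (rule Sup_least, clarify)
    fix s assume "\<forall>z\<in>ball 0 s. P z"
    with assms(1,4) show "ereal s \<le> ereal r"
      by (force simp: not_le[symmetric])
  qed
  show "ereal r \<le> Sup {ereal s | s. 0 < s \<and> ereal s < fps_conv_radius F \<and> (\<forall>z\<in>ball 0 s. P z)}"
    using assms by (intro Sup_upper) auto
qed

text \<open>Re (1 - Q(z)) \<ge> 1 - Q(\<bar>z\<bar>) > 0 for \<bar>z\<bar> < r, while at z = r the
  real part is exactly 0.\<close>

lemma radius_of_convexity_bessel_f:
  assumes R: "zero_free_radius \<nu> R" and j': "j' < R" "bessel_S \<nu> j' = \<nu>"
    and r: "0 < r" "r < j'" "bessel_Q \<nu> r = 1"
  shows "radius_of_convexity (bessel_f \<nu>) = ereal r"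
  unfolding radius_of_convexity_def Let_def
proof (rule radius_Sup_eq)
  have \<nu>: "\<nu> > 0" using R by (simp add: zero_free_radius_def)
  show "ereal r < fps_conv_radius (bessel_f \<nu>)"
    using bessel_f_props(1)[OF R] r j' by (meson less_ereal.simps(1) less_le_trans less_trans)
  show "deriv (eval_fps (bessel_f \<nu>)) z \<noteq> 0 \<and>
      0 < Re (1 + z * deriv (deriv (eval_fps (bessel_f \<nu>))) z / deriv (eval_fps (bessel_f \<nu>)) z)"
    if "norm z < r" for z
  proof -
    have z: "norm z < R" "norm z < j'" using that r j' by auto
    have "Re (bessel_Q \<nu> z) \<le> bessel_Q \<nu> (norm z)"
      using norm_bessel_Q_le[OF R j' z(2)] complex_Re_le_cmod order.trans by blast
    also have "\<dots> < 1"
      using bessel_Q_strict_mono[OF R j', of "norm z" r] that r by simp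
    finally show ?thesis
      using bessel_f_quotient[OF R z(1) bessel_S_less(2)[OF R j' z(2)]] by simp
  qed
  have "norm (complex_of_real r) < R" "norm (complex_of_real r) < j'" using r j' by auto
  from bessel_f_quotient(2)[OF R this(1) bessel_S_less(2)[OF R j' this(2)]]
  show "\<not> (deriv (eval_fps (bessel_f \<nu>)) (of_real r) \<noteq> 0 \<and>
      0 < Re (1 + of_real r * deriv (deriv (eval_fps (bessel_f \<nu>))) (of_real r) / deriv (eval_fps (bessel_f \<nu>)) (of_real r)))"
    using r by (simp add: bessel_Q_of_real \<nu>)
qed fact

text \<open>\<bar>Q\<bar> < 1/2 implies \<bar>Q\<bar> < 1 - \<bar>Q\<bar> \<le> Re (1 - Q); at z = r
  both sides of the defining inequality equal 1/2.\<close>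

lemma radius_of_uniform_convexity_bessel_f:
  assumes R: "zero_free_radius \<nu> R" and j': "j' < R" "bessel_S \<nu> j' = \<nu>"
    and r: "0 < r" "r < j'" "bessel_Q \<nu> r = 1 / 2"
  shows "radius_of_uniform_convexity (bessel_f \<nu>) = ereal r"
  unfolding radius_of_uniform_convexity_def Let_def
proof (rule radius_Sup_eq)
  have \<nu>: "\<nu> > 0" using R by (simp add: zero_free_radius_def)
  show "ereal r < fps_conv_radius (bessel_f \<nu>)"
    using bessel_f_props(1)[OF R] r j' by (meson less_ereal.simps(1) less_le_trans less_trans)
  show "deriv (eval_fps (bessel_f \<nu>)) z \<noteq> 0 \<and>
      norm (z * deriv (deriv (eval_fps (bessel_f \<nu>))) z / deriv (eval_fps (bessel_f \<nu>)) z)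
      < Re (1 + z * deriv (deriv (eval_fps (bessel_f \<nu>))) z / deriv (eval_fps (bessel_f \<nu>)) z)"
    if "norm z < r" for z
  proof -
    have z: "norm z < R" "norm z < j'" using that r j' by auto
    have "norm (bessel_Q \<nu> z) \<le> bessel_Q \<nu> (norm z)"
      by (rule norm_bessel_Q_le[OF R j' z(2)])
    also have "\<dots> < 1 / 2"
      using bessel_Q_strict_mono[OF R j', of "norm z" r] that r by simp
    finally have "norm (bessel_Q \<nu> z) < Re (1 - bessel_Q \<nu> z)"
      using complex_Re_le_cmod[of "bessel_Q \<nu> z"] by simp
    then show ?thesis
      using bessel_f_quotient[OF R z(1) bessel_S_less(2)[OF R j' z(2)]] by simp
  qed
  have "norm (complex_of_real r) < R" "norm (complex_of_real r) < j'" using r j' by auto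
  from bessel_f_quotient(2)[OF R this(1) bessel_S_less(2)[OF R j' this(2)]]
  show "\<not> (deriv (eval_fps (bessel_f \<nu>)) (of_real r) \<noteq> 0 \<and>
      norm (of_real r * deriv (deriv (eval_fps (bessel_f \<nu>))) (of_real r) / deriv (eval_fps (bessel_f \<nu>)) (of_real r))
      < Re (1 + of_real r * deriv (deriv (eval_fps (bessel_f \<nu>))) (of_real r) / deriv (eval_fps (bessel_f \<nu>)) (of_real r)))"
    using r by (simp add: bessel_Q_of_real \<nu>)
qed fact

text \<open>Put u = x J' / J = \<nu> - S. Then T = x^2 - \<nu>^2 + u^2, and the left side of the
  equation becomes 2 Q - 1.\<close>

lemma uniform_convexity_equation_iff:
  assumes \<nu>: "\<nu> > 0" and x: "x > 0" "bessel_E \<nu> x \<noteq> 0" "bessel_S \<nu> x \<noteq> \<nu>"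
  shows "uniform_convexity_equation \<nu> x \<longleftrightarrow> bessel_Q \<nu> x = 1 / 2"
proof -
  define u where "u = \<nu> - bessel_S \<nu> x"
  define J where "J = bessel_J \<nu> x"
  have u: "u \<noteq> 0" using x by (simp add: u_def)
  have J: "J \<noteq> 0" using x \<nu> by (simp add: J_def bessel_J_eq_0_iff)
  have J': "x * deriv (bessel_J \<nu>) x = u * J"
    using deriv_bessel_J[OF \<nu> x(1,2)] by (simp add: u_def J_def)
  have "deriv (bessel_J \<nu>) x \<noteq> 0"
    using J' u J x(1) by auto
  moreover have "(x\<^sup>2 - \<nu>\<^sup>2) * J / (u * J) = (x\<^sup>2 - \<nu>\<^sup>2) / u" "u * J / J = u"
    using J by auto
  moreover have "2 * bessel_Q \<nu> x - 1 = 1 + 2 * ((x\<^sup>2 - \<nu>\<^sup>2) / u) + 2 * (1 - 1 / \<nu>) * u"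
  proof -
    have T: "bessel_T \<nu> x = x\<^sup>2 - \<nu>\<^sup>2 + u\<^sup>2"
      by (simp add: bessel_T_def u_def power2_eq_square algebra_simps)
    have S: "bessel_S \<nu> x = \<nu> - u" by (simp add: u_def)
    have "bessel_Q \<nu> x = (\<nu> - u) / \<nu> + (x\<^sup>2 - \<nu>\<^sup>2 + u\<^sup>2) / u"
      unfolding bessel_Q_def T by (simp add: S)
    also have "\<dots> = 1 - u / \<nu> + (x\<^sup>2 - \<nu>\<^sup>2) / u + u"
      using \<nu> u by (simp add: add_divide_distrib diff_divide_distrib power2_eq_square)
    finally have "bessel_Q \<nu> x = 1 - u / \<nu> + (x\<^sup>2 - \<nu>\<^sup>2) / u + u" .
    moreover have "2 * (1 - 1 / \<nu>) * u = 2 * u - 2 * (u / \<nu>)"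
      by (simp add: algebra_simps)
    ultimately show ?thesis by linarith
  qed
  moreover have "uniform_convexity_equation \<nu> x \<longleftrightarrow> J \<noteq> 0 \<and> deriv (bessel_J \<nu>) x \<noteq> 0 \<and>
      1 + 2 * ((x\<^sup>2 - \<nu>\<^sup>2) * J / (u * J)) + 2 * (1 - 1 / \<nu>) * (u * J / J) = 0"
    unfolding uniform_convexity_equation_def J' J_def ..
  ultimately have "uniform_convexity_equation \<nu> x \<longleftrightarrow> 2 * bessel_Q \<nu> x - 1 = 0"
    using J by (simp only: not_False_eq_True simp_thms)
  then show ?thesis by auto
qed

theorem theorem3p1:
  fixes \<nu> :: real
  assumes "\<nu> > 0"
  shows "\<exists>r j j'.
      smallest_positive (uniform_convexity_equation \<nu>) r \<and>
      radius_of_uniform_convexity (bessel_f \<nu>) = ereal r \<and>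
      smallest_positive (\<lambda>x. bessel_J \<nu> x = 0) j \<and>
      smallest_positive (\<lambda>x. deriv (bessel_J \<nu>) x = 0) j' \<and>
      radius_of_uniform_convexity (bessel_f \<nu>) < radius_of_convexity (bessel_f \<nu>) \<and>
      radius_of_convexity (bessel_f \<nu>) < ereal j' \<and>
      j' < j"
proof -
  obtain j :: real where j: "j > 0" "bessel_E \<nu> j = 0" "\<forall>x. 0 \<le> x \<longrightarrow> x < j \<longrightarrow> bessel_E \<nu> x \<noteq> 0"
    using bessel_E_first_zero[OF assms] by blast
  have R: "zero_free_radius \<nu> j"
    using zero_free_radiusI[of \<nu> j] assms j(1,3) by simp
  \<comment> \<open>J vanishes at both 0 and j, so Rolle's theorem supplies a zero of J' in
    between.\<close>
  have "\<exists>z. 0 < z \<and> z < j \<and> DERIV (bessel_J \<nu>) z :> 0"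
  proof (rule Rolle)
    show "bessel_J \<nu> 0 = bessel_J \<nu> j"
      using assms j by (simp add: bessel_J_eq_real)
    have "continuous_on {0..j} (\<lambda>x. (x / 2) powr \<nu> / Gamma (\<nu> + 1) * bessel_E \<nu> x)"
      using assms Gamma_plus1_neq_0[OF assms]
      by (intro continuous_on_mult continuous_on_divide continuous_on_powr' continuous_on_const
          continuous_on_id continuous_on_bessel_E) auto
    then show "continuous_on {0..j} (bessel_J \<nu>)"
      by (rule continuous_on_eq) (use assms in \<open>simp add: bessel_J_eq_real\<close>)
    show "bessel_J \<nu> differentiable (at x)" if "0 < x" "x < j" for x
      unfolding real_differentiable_def using has_field_derivative_bessel_J[OF assms that(1)] ..
  qed fact
  then obtain j' where j': "0 < j'" "j' < j" "DERIV (bessel_J \<nu>) j' :> 0"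
    by blast
  \<comment> \<open>J has no zero in (0, j). As S is strictly increasing there, the zero of J' from
    Rolle's theorem is the first positive one.\<close>
  have S_iff: "deriv (bessel_J \<nu>) x = 0 \<longleftrightarrow> bessel_S \<nu> x = \<nu>" if "0 < x" "x < j" for x
    using deriv_bessel_J[OF assms that(1)] bessel_J_eq_0_iff[OF assms that(1)] j(3)[rule_format, of x] that by auto
  have S: "bessel_S \<nu> j' = \<nu>"
    using S_iff[OF j'(1,2)] DERIV_imp_deriv[OF j'(3)] by simp
  obtain r :: real where r: "0 < r" "r < j'" "bessel_Q \<nu> r = 1 / 2"
    by (rule bessel_Q_attains[OF R j'(1,2) S, of "1 / 2"]) simp
  obtain c :: real where c: "0 < c" "c < j'" "bessel_Q \<nu> c = 1"
    by (rule bessel_Q_attains[OF R j'(1,2) S, of 1]) simp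
  have "r < c"
  proof (rule ccontr)
    assume "\<not> r < c"
    with r c have "c < r" by (cases "c = r") auto
    then show False
      using bessel_Q_strict_mono[OF R j'(2) S, of c r] r c by simp
  qed
  have S_less: "bessel_S \<nu> x < \<nu>" if "0 < x" "x < j'" for x
    using bessel_S_strict_mono[OF R, of x j'] that j' S by simp
  have eqn: "uniform_convexity_equation \<nu> x \<longleftrightarrow> bessel_Q \<nu> x = 1 / 2" if "0 < x" "x < j'" for x
    using that j' j(3)[rule_format, of x] S_less[of x] by (intro uniform_convexity_equation_iff assms) auto
  show ?thesis
  proof (intro exI conjI)
    show "smallest_positive (uniform_convexity_equation \<nu>) r"
      unfolding smallest_positive_def
    proof (intro conjI allI impI)
      show "uniform_convexity_equation \<nu> r" using r eqn by blast
      show "r \<le> s" if "0 < s \<and> uniform_convexity_equation \<nu> s" for s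
      \<comment> \<open>A root s < r lies below j', where the equation means Q(s) = 1/2, but Q(s) <
        Q(r) = 1/2.\<close>
      proof (rule ccontr)
        assume "\<not> r \<le> s"
        then have "s < r" by simp
        then show False
          using bessel_Q_strict_mono[OF R j'(2) S, of s r] eqn[of s] r that by simp
      qed
    qed fact
    show "smallest_positive (\<lambda>x. bessel_J \<nu> x = 0) j"
      unfolding smallest_positive_def
    proof (intro conjI allI impI)
      show "bessel_J \<nu> j = 0" using j by (simp add: bessel_J_eq_0_iff[OF assms])
      show "j \<le> x" if "0 < x \<and> bessel_J \<nu> x = 0" for x
        using j(3)[rule_format, of x] bessel_J_eq_0_iff[OF assms, of x] that by linarith
    qed fact
    show "smallest_positive (\<lambda>x. deriv (bessel_J \<nu>) x = 0) j'"
      unfolding smallest_positive_def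
    proof (intro conjI allI impI)
      show "deriv (bessel_J \<nu>) j' = 0" by (rule DERIV_imp_deriv[OF j'(3)])
      show "j' \<le> x" if "0 < x \<and> deriv (bessel_J \<nu>) x = 0" for x
        using S_iff[of x] S_less[of x] j'(2) that by linarith
    qed fact+
    show "radius_of_uniform_convexity (bessel_f \<nu>) = ereal r"
      by (rule radius_of_uniform_convexity_bessel_f[OF R j'(2) S r])
    then show "radius_of_uniform_convexity (bessel_f \<nu>) < radius_of_convexity (bessel_f \<nu>)"
      using radius_of_convexity_bessel_f[OF R j'(2) S c] \<open>r < c\<close> by simp
    show "radius_of_convexity (bessel_f \<nu>) < ereal j'"
      using radius_of_convexity_bessel_f[OF R j'(2) S c] c by simp
  qed fact
qed

end
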